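(* For every $\alpha\in(0,\pi/2)$ there exists a Borel probability measure $\mu$ on $\mathbb{C}$, symmetric with respect to the real line (i.e. $\mu(E)=\mu(\{\overline{z}:z\in E\})$ for every Borel set $E\subset\mathbb{C}$), whose potential $u_\mu$ satisfies $u_\mu(z)\le u_\mu(|z|)$ for all $z\in\mathbb{C}$, and such that $$\mu\{z\in\mathbb{C}^*:|\mathrm{Arg}\, z|\le\alpha\}=\frac{2\alpha}{\pi}.$$
   Context: $\mathbb{C}^*=\mathbb{C}\setminus\{0\}$, and $\mathrm{Arg}\, z\in(-\pi,\pi]$ is the principal argument of $z\in\mathbb{C}^*$. For a finite (positive Borel) measure $\mu$ on $\mathbb{C}$, its potential is the function $u_\mu:\mathbb{C}\to[-\infty,\infty)$, $$u_\mu(z)=\int_{|\zeta|\le1}\log|z-\zeta|\,d\mu(\zeta)+\int_{|\zeta|>1}\log\left|1-\frac{z}{\zeta}\right|d\mu(\zeta).$$ *)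

theory Defs
  imports "HOL-Probability.Probability"
begin

text \<open>
  The library has \<open>ln 0 = 0\<close>, whereas potential theory needs \<open>log 0 = -\<infinity>\<close>.
\<close>

definition elog :: "real \<Rightarrow> ereal" where
  "elog x = (if x \<le> 0 then -\<infinity> else ereal (ln x))"

text \<open>
  The Lebesgue integral over \<open>A\<close> of an extended-real function, as the integral of the positive
  part minus that of the negative part (\<open>e2ennreal\<close> sends negative values to \<open>0\<close>).  It has its
  usual meaning unless both parts are infinite.  In the potential of a finite measure the
  positive parts are always finite, since \<open>\<bar>z - \<zeta>\<bar> \<le> 1 + \<bar>z\<bar>\<close> for \<open>\<bar>\<zeta>\<bar> \<le> 1\<close> and
  \<open>\<bar>1 - z / \<zeta>\<bar> \<le> 1 + \<bar>z\<bar>\<close> for \<open>\<bar>\<zeta>\<bar> > 1\<close>; the Bochner integral would instead return \<open>0\<close> where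
  the potential is \<open>-\<infinity>\<close>.
\<close>

definition ereal_set_integral :: "'a measure \<Rightarrow> 'a set \<Rightarrow> ('a \<Rightarrow> ereal) \<Rightarrow> ereal" where
  "ereal_set_integral M A f =
     enn2ereal (\<integral>\<^sup>+x\<in>A. e2ennreal (f x) \<partial>M) - enn2ereal (\<integral>\<^sup>+x\<in>A. e2ennreal (- f x) \<partial>M)"

definition potential :: "complex measure \<Rightarrow> complex \<Rightarrow> ereal" where
  "potential \<mu> z =
     ereal_set_integral \<mu> {\<zeta>. cmod \<zeta> \<le> 1} (\<lambda>\<zeta>. elog (cmod (z - \<zeta>))) +
     ereal_set_integral \<mu> {\<zeta>. cmod \<zeta> > 1} (\<lambda>\<zeta>. elog (cmod (1 - z / \<zeta>)))"

definition symmetric_wrt_real_line :: "complex measure \<Rightarrow> bool" where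
  "symmetric_wrt_real_line \<mu> \<longleftrightarrow> (\<forall>E\<in>sets borel. emeasure \<mu> E = emeasure \<mu> (cnj ` E))"

end

theory Submission
  imports Defs "HOL-Complex_Analysis.Complex_Analysis" "HOL-Real_Asymp.Real_Asymp"
begin

text \<open>
  With \<open>\<rho> = pi / \<alpha>\<close>, let \<open>u(z) = log \<bar>1 + z^\<rho>\<bar> / \<rho>\<close> in the sector \<open>\<bar>Arg z\<bar> \<le> 2\<alpha>\<close> and
  \<open>u(z) = log (1 + \<bar>z\<bar>^\<rho>) / \<rho>\<close> outside it.  Clearly \<open>u(z) \<le> u(\<bar>z\<bar>)\<close>.  The two pieces and their
  angular derivatives agree on the boundary rays, where \<open>z^\<rho> > 0\<close>, so the Riesz measure of \<open>u\<close>
  does not charge these rays: it consists of an atom of mass \<open>\<alpha> / pi\<close> at each of \<open>e^(\<plusminus>i\<alpha>)\<close> and,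
  for \<open>2\<alpha> < \<bar>Arg z\<bar>\<close>, of a product measure whose angular part is uniform and for which
  \<open>log \<bar>z\<bar>\<close> has a logistic distribution.

  To see that the potential \<open>p\<close> of this measure satisfies
  \<open>p(z) - p(\<bar>z\<bar>) = u(z) - u(\<bar>z\<bar>)\<close>, put \<open>z = e^(x + i\<theta>)\<close> and let \<open>h(\<tau>)\<close> be the potential of the
  logistic distribution on a single ray seen under the angle \<open>\<tau>\<close>.  The absolutely continuous part
  contributes \<open>(h(t - 2\<alpha>) - h(t + 2\<alpha>)) / (2 pi)\<close> to the angular derivative at \<open>t\<close>.  The logistic function
  \<open>W(w) = e^(\<rho>w) / (1 + e^(\<rho>w))\<close> has period \<open>2i\<alpha>\<close>, so after an integration by parts this
  difference becomes the real part of the integral of \<open>W(w) / (e^(w - x - it) - 1)\<close> around the strip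
  \<open>\<bar>Im w\<bar> \<le> 2\<alpha>\<close>, which the residue theorem evaluates.
\<close>

section \<open>Zeros, residues and integrable majorants\<close>

lemma residue_divide_simple_zero:
  fixes f g :: "complex \<Rightarrow> complex"
  assumes "open S" "z \<in> S" "f holomorphic_on S" "g holomorphic_on S"
    and "f z \<noteq> 0" "g z = 0" "(g has_field_derivative g') (at z)" "g' \<noteq> 0"
  shows "residue (\<lambda>w. f w / g w) z = f z / g'"
proof -
  \<comment> \<open>A ball is connected, while \<open>S\<close> is merely open; later
    \<open>S\<close> is the complement of the zero set of an entire function.\<close>
  obtain e where "e > 0" "ball z e \<subseteq> S" using assms(1,2) openE by blast
  then show ?thesis using assms
    by (intro residue_simple_pole_deriv[where s="ball z e"]) (auto intro: holomorphic_on_subset)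
qed

text \<open>The periods of \<open>exp\<close> are the multiples of \<open>2 * pi * \<i>\<close>, and
  the bound on the imaginary parts leaves only the period zero. This locates the pole of the kernel
  \<open>1 / (exp (w - z) - 1)\<close>.\<close>

lemma exp_minus_one_zeros:
  assumes "exp (w - z) = 1" "\<bar>Im w - Im z\<bar> < 2 * pi"
  shows "w = (z :: complex)"
proof -
  obtain n :: int where n: "Re (w - z) = 0" "Im (w - z) = of_int (2 * n) * pi"
    using assms(1) unfolding exp_eq_1 by blast
  have "\<bar>of_int n * pi\<bar> < 1 * pi" using assms(2) n by simp
  hence "\<bar>of_int n :: real\<bar> < 1" unfolding abs_mult by simp
  hence "n = 0" by linarith
  thus ?thesis using n by (simp add: complex_eq_iff)
qed

text \<open>Nonnegativity turns gauge integrability on the half-line into Lebesgue integrability,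
  and reflection supplies the other half.\<close>

lemma integrable_even_lborel:
  fixes f :: "real \<Rightarrow> real"
  assumes [measurable]: "f \<in> borel_measurable borel"
    and nonneg: "\<And>x. 0 \<le> f x" and even: "\<And>x. f (- x) = f x" and int: "f integrable_on {0..}"
  shows "integrable lborel f"
proof -
  have "set_integrable lebesgue {0..} f"
    using int nonneg by (intro nonnegative_absolutely_integrable_1) auto
  hence i: "integrable lborel (\<lambda>x. indicator {0..} x * f x)"
    unfolding set_integrable_def real_scaleR_def by (subst (asm) integrable_completion) auto
  have "integrable lborel (\<lambda>x. indicator {0..} (0 + (-1) * x) * f (0 + (-1) * x))"
    by (rule lborel_integrable_real_affine[OF i]) simp
  hence "integrable lborel (\<lambda>x. indicator {..0} x * f x)"
    by (simp add: even indicator_def)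
  \<comment> \<open>The sum counts the origin twice, so it serves only as a majorant of
    \<open>f\<close>.\<close>
  with i have "integrable lborel (\<lambda>x. indicator {0..} x * f x + indicator {..0} x * f x)"
    by (rule Bochner_Integration.integrable_add)
  thus ?thesis
    by (rule Bochner_Integration.integrable_bound) (auto simp: indicator_def nonneg)
qed

lemma integrable_exp_minus_abs:
  assumes "c > 0"
  shows "integrable lborel (\<lambda>x::real. exp (- c * \<bar>x\<bar>))"
proof (rule integrable_even_lborel)
  have "(\<lambda>x. exp (- c * x)) integrable_on {0..}"
    by (rule integrable_on_exp_minus_to_infinity[OF assms])
  thus "(\<lambda>x. exp (- c * \<bar>x\<bar>)) integrable_on {0..}"
    by (rule integrable_eq) auto
qed auto

text \<open>A majorant for the logarithmic singularity. Its antiderivative \<open>2 * sqrt x\<close>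
  is continuous but not differentiable at the origin, hence the interior form of the fundamental
  theorem.\<close>

lemma integrable_inverse_sqrt:
  "integrable lborel (\<lambda>x::real. indicator {-1..1} x / sqrt \<bar>x\<bar>)"
proof (rule integrable_even_lborel)
  have "((\<lambda>x. 1 / sqrt x) has_integral (2 * sqrt 1 - 2 * sqrt 0)) {0..1::real}"
    by (rule fundamental_theorem_of_calculus_interior)
      (auto intro!: continuous_intros derivative_eq_intros
            simp: has_real_derivative_iff_has_vector_derivative[symmetric] field_simps)
  hence "(\<lambda>x. 1 / sqrt x) integrable_on {0..1::real}" by blast
  hence "(\<lambda>x. if x \<in> {0..1} then 1 / sqrt x else 0) integrable_on {0..}"
    by (subst integrable_restrict_Int) (simp add: Int_absorb2)
  thus "(\<lambda>x. indicator {-1..1} x / sqrt \<bar>x\<bar>) integrable_on {0..}"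
    by (rule integrable_eq) (auto simp: indicator_def)
qed (auto simp: indicator_def)

text \<open>The inequality \<open>ln v \<le> v - 1\<close> is applied to
  \<open>\<bar>u\<bar>\<close> far from the origin and to \<open>1 / sqrt \<bar>u\<bar>\<close> near
  it. At \<open>u = 0\<close> both sides vanish, by \<open>ln 0 = 0\<close> and division by
  zero.\<close>

lemma abs_ln_abs_le:
  fixes u :: real
  shows "\<bar>ln \<bar>u\<bar>\<bar> \<le> \<bar>u\<bar> + 2 * (indicator {-1..1} u / sqrt \<bar>u\<bar>)"
proof (cases "u = 0 \<or> \<bar>u\<bar> > 1")
  case True
  have "\<bar>u\<bar> > 1 \<Longrightarrow> ln \<bar>u\<bar> \<le> \<bar>u\<bar> - 1" by (intro ln_le_minus_one) auto
  with True show ?thesis by (auto simp: indicator_def abs_if)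
next
  case False
  hence u: "0 < \<bar>u\<bar>" "\<bar>u\<bar> \<le> 1" by auto
  have "ln (1 / sqrt \<bar>u\<bar>) \<le> 1 / sqrt \<bar>u\<bar> - 1" using u by (intro ln_le_minus_one) auto
  moreover have "ln (1 / sqrt \<bar>u\<bar>) = - ln \<bar>u\<bar> / 2" using u by (simp add: ln_div ln_sqrt)
  moreover have "ln \<bar>u\<bar> \<le> 0" using u by simp
  ultimately have "\<bar>ln \<bar>u\<bar>\<bar> \<le> 2 * (1 / sqrt \<bar>u\<bar>)" by linarith
  also have "\<dots> \<le> \<bar>u\<bar> + 2 * (indicator {-1..1} u / sqrt \<bar>u\<bar>)" using u by (auto simp: indicator_def)
  finally show ?thesis .
qed

section \<open>The logarithmic kernel in logarithmic polar coordinates\<close>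

text \<open>By the law of cosines, two points with polar data \<open>(exp x, s)\<close> and
  \<open>(exp y, t)\<close> have squared distance
  \<open>2 * exp (x + y) * (cosh (y - x) - cos (s - t))\<close>. So with \<open>u = y - x\<close>
  and \<open>\<tau> = s - t\<close> this is the logarithm of their distance up to a term free of the
  angles.\<close>

definition log_kernel :: "real \<Rightarrow> real \<Rightarrow> real" where
  "log_kernel u \<tau> = ln (cosh u - cos \<tau>) / 2"

text \<open>Free of the angle, as dominated convergence in the angle requires.\<close>

definition log_kernel_bound :: "real \<Rightarrow> real" where
  "log_kernel_bound u = ln 2 + \<bar>u\<bar> + \<bar>ln \<bar>u\<bar>\<bar>"

text \<open>The identity \<open>cosh u = 1 + 2 * (sinh (u/2))\<^sup>2\<close> reduces this to
  \<open>\<bar>v\<bar> \<le> \<bar>sinh v\<bar>\<close>.\<close>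

lemma cosh_ge_1_plus_half_square: "1 + u\<^sup>2 / 2 \<le> cosh (u :: real)"
proof -
  have "\<bar>u / 2\<bar> \<le> \<bar>sinh (u / 2)\<bar>"
    using real_le_abs_sinh[of "u / 2"] by (simp add: sinh_field_def exp_minus)
  hence "(u / 2)\<^sup>2 \<le> (sinh (u / 2))\<^sup>2" by (simp only: abs_le_square_iff)
  moreover have "cosh u = 1 + 2 * (sinh (u/2))\<^sup>2"
    using cosh_double[of "u/2"] cosh_square_eq[of "u/2"] by simp
  ultimately show ?thesis by (simp add: power_divide)
qed

lemma cosh_minus_cos_pos_iff: "0 < cosh u - cos \<tau> \<longleftrightarrow> u \<noteq> 0 \<or> cos \<tau> \<noteq> (1 :: real)"
proof -
  have "cos \<tau> < cosh u" if "u \<noteq> 0 \<or> cos \<tau> \<noteq> 1"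
  proof (cases "u = 0")
    case True
    thus ?thesis using that cos_le_one[of \<tau>] by (simp add: less_le)
  next
    case False
    hence "0 < u\<^sup>2" by simp
    thus ?thesis using cosh_ge_1_plus_half_square[of u] cos_le_one[of \<tau>] by linarith
  qed
  thus ?thesis by auto
qed

lemma cosh_le_exp_abs: "cosh u \<le> exp \<bar>u\<bar>" for u :: real
  unfolding cosh_def by (cases "u \<ge> 0") auto

text \<open>The argument of the logarithm lies between \<open>u\<^sup>2 / 2\<close> and
  \<open>2 * exp \<bar>u\<bar>\<close>.\<close>

lemma abs_log_kernel_le:
  assumes "u \<noteq> 0"
  shows "\<bar>log_kernel u \<tau>\<bar> \<le> log_kernel_bound u"
proof -
  have pos: "0 < cosh u - cos \<tau>" using assms by (simp only: cosh_minus_cos_pos_iff) simp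
  have "cosh u - cos \<tau> \<le> 2 * exp \<bar>u\<bar>"
    using cosh_le_exp_abs[of u] cos_ge_minus_one[of \<tau>] one_le_exp_iff[of "\<bar>u\<bar>"] by linarith
  hence "ln (cosh u - cos \<tau>) \<le> ln (2 * exp \<bar>u\<bar>)" using pos by simp
  also have "\<dots> = ln 2 + \<bar>u\<bar>" by (simp add: ln_mult)
  finally have upper: "ln (cosh u - cos \<tau>) \<le> ln 2 + \<bar>u\<bar>" .
  have "u\<^sup>2 / 2 \<le> cosh u - cos \<tau>"
    using cosh_ge_1_plus_half_square[of u] cos_le_one[of \<tau>] by linarith
  hence "ln (u\<^sup>2 / 2) \<le> ln (cosh u - cos \<tau>)" using pos assms by simp
  moreover have "ln (u\<^sup>2 / 2) = 2 * ln \<bar>u\<bar> - ln 2"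
    using assms ln_realpow[of "\<bar>u\<bar>" 2] by (simp add: ln_div)
  ultimately have lower: "2 * ln \<bar>u\<bar> - ln 2 \<le> ln (cosh u - cos \<tau>)" by simp
  have "(0::real) < ln 2" by simp
  thus ?thesis using upper lower unfolding log_kernel_def log_kernel_bound_def by linarith
qed

text \<open>This is the law of cosines; the hypothesis keeps the two points apart.\<close>

lemma cmod_exp_diff:
  assumes "x \<noteq> y \<or> cos (s - t) \<noteq> 1"
  shows "exp (Complex x s) \<noteq> exp (Complex y t)"
    and "ln (cmod (exp (Complex x s) - exp (Complex y t))) = (ln 2 + x + y) / 2 + log_kernel (y - x) (s - t)"
proof -
  let ?d = "exp (Complex x s) - exp (Complex y t)"
  have "(cmod ?d)\<^sup>2 = (exp x * cos s - exp y * cos t)\<^sup>2 + (exp x * sin s - exp y * sin t)\<^sup>2"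
    by (simp add: cmod_power2 Re_exp Im_exp)
  also have "\<dots> = exp x ^ 2 * ((cos s)\<^sup>2 + (sin s)\<^sup>2) + exp y ^ 2 * ((cos t)\<^sup>2 + (sin t)\<^sup>2)
      - 2 * (exp x * exp y) * (cos s * cos t + sin s * sin t)"
    by algebra
  also have "\<dots> = 2 * exp (x + y) * (cosh (y - x) - cos (s - t))"
    by (simp add: cosh_def exp_diff exp_minus exp_add cos_diff field_simps power2_eq_square)
  finally have sq: "(cmod ?d)\<^sup>2 = 2 * exp (x + y) * (cosh (y - x) - cos (s - t))" .
  have pos: "0 < cosh (y - x) - cos (s - t)" unfolding cosh_minus_cos_pos_iff using assms by auto
  show "exp (Complex x s) \<noteq> exp (Complex y t)" using sq pos by force
  hence "2 * ln (cmod ?d) = ln ((cmod ?d)\<^sup>2)" by (simp add: ln_realpow)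
  also have "\<dots> = ln 2 + (x + y) + ln (cosh (y - x) - cos (s - t))"
    unfolding sq using pos by (simp add: ln_mult)
  finally show "ln (cmod ?d) = (ln 2 + x + y) / 2 + log_kernel (y - x) (s - t)"
    unfolding log_kernel_def by (simp add: field_simps | argo | algebra)
qed

text \<open>The real part is \<open>1/2\<close> minus the derivative of \<open>log_kernel\<close> in
  its first argument, and the imaginary part is its derivative in the second. In this way contour
  integrals yield derivatives of logarithmic potentials.\<close>

lemma minus_inverse_exp_minus_one:
  assumes "u \<noteq> 0 \<or> cos v \<noteq> 1"
  shows "- 1 / (exp (Complex u v) - 1)
    = Complex (1/2 - sinh u / (2 * (cosh u - cos v))) (sin v / (2 * (cosh u - cos v)))"
proof -
  have pos: "0 < cosh u - cos v" unfolding cosh_minus_cos_pos_iff using assms by auto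
  define p q where "p = exp u * cos v - 1" and "q = exp u * sin v"
  have e: "exp (Complex u v) - 1 = Complex p q" by (simp add: complex_eq_iff Re_exp Im_exp p_def q_def)
  have "p\<^sup>2 + q\<^sup>2 = exp u ^ 2 * ((cos v)\<^sup>2 + (sin v)\<^sup>2) + 1 - 2 * exp u * cos v"
    unfolding p_def q_def by algebra
  also have "\<dots> = 2 * exp u * (cosh u - cos v)"
    by (simp add: cosh_def exp_minus field_simps power2_eq_square)
  finally have n: "p\<^sup>2 + q\<^sup>2 = 2 * exp u * (cosh u - cos v)" .
  have c: "cosh u - cos v - sinh u = exp (-u) - cos v" by (simp add: cosh_field_def sinh_field_def field_simps)
  have "1/2 - sinh u / (2 * (cosh u - cos v)) = (cosh u - cos v - sinh u) / (2 * (cosh u - cos v))"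
    using pos by (simp add: field_simps)
  also have "\<dots> = - p / (p\<^sup>2 + q\<^sup>2)"
    unfolding n unfolding c p_def using pos by (simp add: divide_simps exp_minus)
  finally have re: "- p / (p\<^sup>2 + q\<^sup>2) = 1/2 - sinh u / (2 * (cosh u - cos v))" by simp
  have im: "q / (p\<^sup>2 + q\<^sup>2) = sin v / (2 * (cosh u - cos v))"
    unfolding n unfolding q_def using pos by simp
  show ?thesis unfolding e using re im
    by (simp add: complex_eq_iff Re_divide Im_divide)
qed

text \<open>Each kernel grows like half of \<open>\<bar>y\<bar>\<close>, but the angle enters only
  in lower order. This removes the boundary terms of the integration by parts.\<close>

lemma log_kernel_diff_tendsto:
  "((\<lambda>y. log_kernel (y - x) a - log_kernel (y - x) b) \<longlongrightarrow> 0) at_top"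
  "((\<lambda>y. log_kernel (- y - x) a - log_kernel (- y - x) b) \<longlongrightarrow> 0) at_top"
  unfolding log_kernel_def cosh_field_def by real_asymp+

text \<open>These products bound the integrand on the vertical sides of the rectangle: on the right
  the kernel decays, on the left the logistic factor does.\<close>

lemma vertical_bounds_tendsto:
  fixes x \<rho> :: real
  assumes "\<rho> > 0"
  shows "((\<lambda>R. exp (\<rho> * R) / (exp (\<rho> * R) - 1) * (1 / (exp (R - x) - 1))) \<longlongrightarrow> 0) at_top"
    and "((\<lambda>R. exp (- \<rho> * R) / (1 - exp (- \<rho> * R)) * (1 / (1 - exp (- R - x)))) \<longlongrightarrow> 0) at_top"
  using assms by real_asymp+

text \<open>As \<open>f\<close> is already known to be integrable, dominated convergence along
  integer \<open>R\<close> identifies the limit of the truncated integrals with the Lebesgue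
  integral.\<close>

lemma tendsto_integral_symmetric_interval:
  fixes f :: "real \<Rightarrow> real"
  assumes int: "integrable lborel f" and I: "eventually (\<lambda>R. (f has_integral I R) {-R..R}) at_top"
    and L: "(I \<longlongrightarrow> L) at_top"
  shows "integral\<^sup>L lborel f = L"
proof -
  have [measurable]: "f \<in> borel_measurable borel" using borel_measurable_integrable[OF int] by simp
  have I': "eventually (\<lambda>n. (f has_integral I (real n)) {-real n..real n}) sequentially"
    by (rule eventually_compose_filterlim[OF I filterlim_real_sequentially])
  have "(\<lambda>n. \<integral>y. indicator {-real n..real n} y * f y \<partial>lborel) \<longlonglongrightarrow> integral\<^sup>L lborel f"
  proof (rule integral_dominated_convergence[where w="\<lambda>y. norm (f y)"])
    show "AE y in lborel. (\<lambda>n. indicator {-real n..real n} y * f y) \<longlonglongrightarrow> f y"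
    proof (rule AE_I2)
      fix y :: real
      obtain N :: nat where N: "\<bar>y\<bar> < real N" using reals_Archimedean2 by blast
      have "eventually (\<lambda>n. indicator {-real n..real n} y * f y = f y) sequentially"
        using eventually_ge_at_top[of N] by eventually_elim (use N in \<open>auto simp: indicator_def\<close>)
      thus "(\<lambda>n. indicator {-real n..real n} y * f y) \<longlonglongrightarrow> f y" by (rule tendsto_eventually)
    qed
  qed (use int in \<open>auto simp: indicator_def\<close>)
  moreover have "eventually (\<lambda>n. (\<integral>y. indicator {-real n..real n} y * f y \<partial>lborel) = I (real n)) sequentially"
    using I'
  proof eventually_elim
    case (elim n)
    have "set_integrable lborel {-real n..real n} f"
      unfolding set_integrable_def using int by (intro integrable_mult_indicator) auto
    from set_borel_integral_eq_integral(2)[OF this] elim show ?case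
      by (simp add: set_lebesgue_integral_def integral_unique)
  qed
  ultimately have "(\<lambda>n. I (real n)) \<longlonglongrightarrow> integral\<^sup>L lborel f"
    by (rule Lim_transform_eventually)
  moreover have "(\<lambda>n. I (real n)) \<longlonglongrightarrow> L"
    using L filterlim_real_sequentially by (rule filterlim_compose)
  ultimately show ?thesis by (rule LIMSEQ_unique)
qed

lemma cos_eq_1_imp_zero:
  assumes "cos v = 1" "\<bar>v\<bar> < 2 * pi"
  shows "v = (0 :: real)"
proof -
  obtain n :: int where n: "v = of_int n * 2 * pi" using assms(1) cos_one_2pi_int by blast
  hence "\<bar>of_int n :: real\<bar> < 1" using assms(2) by (simp add: abs_mult)
  hence "n = 0" by linarith
  thus ?thesis using n by simp
qed

lemma borel_measurable_log_kernel [measurable]: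
  assumes [measurable]: "f \<in> borel_measurable M" "g \<in> borel_measurable M"
  shows "(\<lambda>w. log_kernel (f w) (g w)) \<in> borel_measurable M"
proof -
  have [measurable]: "(cosh :: real \<Rightarrow> real) \<in> borel_measurable borel"
      "(cos :: real \<Rightarrow> real) \<in> borel_measurable borel"
    by (intro borel_measurable_continuous_onI continuous_intros)+
  show ?thesis unfolding log_kernel_def by measurable
qed

text \<open>Here \<open>Q\<close> integrates the rotated \<open>h\<close> over
  \<open>c \<le> \<bar>\<phi>\<bar> \<le> pi\<close>. Written with an antiderivative
  \<open>H\<close>, it involves \<open>H\<close> at \<open>t \<plusminus> pi\<close> and
  \<open>t \<plusminus> c\<close>; after differentiation the terms at
  \<open>t \<plusminus> pi\<close> cancel by periodicity.\<close>

lemma rotation_average_diff: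
  fixes h :: "real \<Rightarrow> real"
  assumes cont: "continuous_on UNIV h" and per: "\<And>t. h (t + 2 * pi) = h t"
    and c: "0 \<le> c" "c \<le> pi" and \<theta>: "0 \<le> \<theta>" "\<theta> \<le> pi"
  defines "Q \<equiv> (\<lambda>\<theta>. integral {-pi..-c} (\<lambda>\<phi>. h (\<theta> - \<phi>)) + integral {c..pi} (\<lambda>\<phi>. h (\<theta> - \<phi>)))"
  shows "((\<lambda>t. h (t - c) - h (t + c)) has_integral Q \<theta> - Q 0) {0..\<theta>}"
proof -
  \<comment> \<open>All arguments of \<open>H\<close> below lie between \<open>-pi\<close> and
    \<open>2 * pi\<close>, so this interval leaves room for two-sided derivatives.\<close>
  obtain H where H: "\<And>t. t \<in> {-4*pi..4*pi} \<Longrightarrow> (H has_vector_derivative h t) (at t within {-4*pi..4*pi})"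
    using antiderivative_continuous[OF continuous_on_subset[OF cont subset_UNIV]] by blast
  have H': "(H has_real_derivative h t) (at t)" if "-4*pi < t" "t < 4*pi" for t
  proof -
    have "at t within {-4*pi..4*pi} = at t" using that by (intro at_within_interior) (simp add: interior_atLeastAtMost_real)
    thus ?thesis using H[of t] that by (simp add: has_real_derivative_iff_has_vector_derivative)
  qed
  have piece: "integral {a..b} (\<lambda>\<phi>. h (\<theta> - \<phi>)) = H (\<theta> - a) - H (\<theta> - b)"
    if "- pi \<le> a" "a \<le> b" "b \<le> pi" "0 \<le> \<theta>" "\<theta> \<le> pi" for a b \<theta>
  proof -
    have "((\<lambda>\<phi>. h (\<theta> - \<phi>)) has_integral (- H (\<theta> - b) - - H (\<theta> - a))) {a..b}"
    proof (rule fundamental_theorem_of_calculus[OF that(2)])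
      fix \<phi> assume "\<phi> \<in> {a..b}"
      hence "(H has_real_derivative h (\<theta> - \<phi>)) (at (\<theta> - \<phi>))"
        using that pi_gt_zero by (intro H'; simp; linarith)
      moreover have "((\<lambda>\<phi>. \<theta> - \<phi>) has_real_derivative - 1) (at \<phi>)"
        by (auto intro!: derivative_eq_intros)
      ultimately have "((\<lambda>\<phi>. H (\<theta> - \<phi>)) has_real_derivative h (\<theta> - \<phi>) * - 1) (at \<phi>)"
        by (rule DERIV_chain2)
      from DERIV_minus[OF this]
      have "((\<lambda>\<phi>. - H (\<theta> - \<phi>)) has_real_derivative h (\<theta> - \<phi>)) (at \<phi>)" by simp
      thus "((\<lambda>\<phi>. - H (\<theta> - \<phi>)) has_vector_derivative h (\<theta> - \<phi>)) (at \<phi> within {a..b})"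
        using has_real_derivative_iff_has_vector_derivative has_vector_derivative_at_within by blast
    qed
    thus ?thesis by (simp add: integral_unique)
  qed
  have Q: "Q t = (H (t + pi) - H (t + c)) + (H (t - c) - H (t - pi))" if "0 \<le> t" "t \<le> pi" for t
    unfolding Q_def using c that by (subst (1 2) piece) auto
  have "((\<lambda>t. h (t - c) - h (t + c)) has_integral
     ((H (\<theta> + pi) - H (\<theta> + c)) + (H (\<theta> - c) - H (\<theta> - pi))) - ((H (0 + pi) - H (0 + c)) + (H (0 - c) - H (0 - pi)))) {0..\<theta>}"
  proof (rule fundamental_theorem_of_calculus[OF \<theta>(1)])
    fix t assume t: "t \<in> {0..\<theta>}"
    have d: "((\<lambda>t. H (t + s)) has_real_derivative h (t + s)) (at t)" if "\<bar>s\<bar> \<le> pi" for s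
    proof -
      have "(H has_real_derivative h (t + s)) (at (t + s))"
        using that t \<theta> pi_gt_zero by (intro H'; simp; linarith)
      moreover have "((\<lambda>t. t + s) has_real_derivative 1) (at t)"
        by (auto intro!: derivative_eq_intros)
      ultimately have "((\<lambda>t. H (t + s)) has_real_derivative h (t + s) * 1) (at t)"
        by (rule DERIV_chain2)
      thus ?thesis by simp
    qed
    have "((\<lambda>t. (H (t + pi) - H (t + c)) + (H (t + (-c)) - H (t + (- pi)))) has_real_derivative
       ((h (t + pi) - h (t + c)) + (h (t + (-c)) - h (t + (- pi))))) (at t)"
      using c by (intro DERIV_add DERIV_diff d) auto
    moreover have "h (t + pi) = h (t + (- pi))" using per[of "t - pi"] by (simp add: add.commute)
    ultimately have "((\<lambda>t. (H (t + pi) - H (t + c)) + (H (t - c) - H (t - pi))) has_real_derivative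
       (h (t - c) - h (t + c))) (at t)" by simp
    thus "((\<lambda>t. (H (t + pi) - H (t + c)) + (H (t - c) - H (t - pi))) has_vector_derivative
       (h (t - c) - h (t + c))) (at t within {0..\<theta>})"
      using has_real_derivative_iff_has_vector_derivative has_vector_derivative_at_within by blast
  qed
  thus ?thesis using Q \<theta> by simp
qed

text \<open>For \<open>x = 0\<close> this gives the value filling the gap at the atom, where
  numerator and denominator vanish to second order.\<close>

lemma one_minus_cos_quotient_tendsto:
  fixes \<rho> :: real
  assumes "\<rho> > 0"
  shows "((\<lambda>s. (1 - cos (\<rho> * s)) / (1 - cos s)) \<longlongrightarrow> \<rho>\<^sup>2) (at 0)"
  using assms unfolding power2_eq_square by real_asymp

section \<open>Potentials as Bochner integrals\<close>

text \<open>Integrability makes both nonnegative integrals finite, so their extended-real difference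
  is a difference of real numbers.\<close>

lemma ereal_set_integral_eq_integral:
  assumes int: "integrable M (\<lambda>x. indicator A x * g x)"
    and AE: "AE x in M. x \<in> A \<longrightarrow> f x = ereal (g x)"
  shows "ereal_set_integral M A f = ereal (\<integral>x. indicator A x * g x \<partial>M)"
proof -
  have "(\<integral>\<^sup>+x\<in>A. e2ennreal (f x) \<partial>M) = (\<integral>\<^sup>+x. ennreal (indicator A x * g x) \<partial>M)"
    by (rule nn_integral_cong_AE) (use AE in eventually_elim, auto split: split_indicator simp: e2ennreal_ereal)
  moreover have "(\<integral>\<^sup>+x\<in>A. e2ennreal (- f x) \<partial>M) = (\<integral>\<^sup>+x. ennreal (- (indicator A x * g x)) \<partial>M)"
    by (rule nn_integral_cong_AE) (use AE in eventually_elim, auto split: split_indicator simp: e2ennreal_ereal)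
  moreover have "enn2ereal a = ereal (enn2real a)" if "a \<noteq> \<infinity>" for a :: ennreal
    using that by (cases a) (auto simp: enn2ereal_ennreal)
  ultimately show ?thesis
    using int unfolding ereal_set_integral_def real_integrable_def real_lebesgue_integral_def[OF int] by simp
qed

text \<open>
  Here the logarithm of \<open>\<bar>1 - z / \<zeta>\<bar>\<close> is split, so that the normalising term for \<open>\<bar>\<zeta>\<bar> > 1\<close>
  cancels in the difference of two potentials.
\<close>

definition potential_kernel :: "complex \<Rightarrow> complex \<Rightarrow> real" where
  "potential_kernel z \<zeta> = ln (cmod (z - \<zeta>)) - (if cmod \<zeta> > 1 then ln (cmod \<zeta>) else 0)"

text \<open>Off the null set \<open>\<zeta> = z\<close> the logarithms are finite, and for
  \<open>cmod \<zeta> > 1\<close> the modulus of \<open>1 - z / \<zeta>\<close> is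
  \<open>cmod (z - \<zeta>) / cmod \<zeta>\<close>.\<close>

lemma potential_eq_integral:
  assumes sets [measurable_cong]: "sets \<mu> = sets borel"
    and int: "integrable \<mu> (potential_kernel z)" and AE: "AE \<zeta> in \<mu>. \<zeta> \<noteq> z"
  shows "potential \<mu> z = ereal (\<integral>\<zeta>. potential_kernel z \<zeta> \<partial>\<mu>)"
proof -
  have [measurable]: "{\<zeta>. cmod \<zeta> \<le> 1} \<in> sets \<mu>" "{\<zeta>. cmod \<zeta> > 1} \<in> sets \<mu>"
    unfolding sets by measurable
  have i: "integrable \<mu> (\<lambda>\<zeta>. indicator {\<zeta>. cmod \<zeta> \<le> 1} \<zeta> * potential_kernel z \<zeta>)"
      "integrable \<mu> (\<lambda>\<zeta>. indicator {\<zeta>. cmod \<zeta> > 1} \<zeta> * potential_kernel z \<zeta>)"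
    using int by (auto intro!: integrable_real_mult_indicator simp: mult.commute)
  have "AE \<zeta> in \<mu>. \<zeta> \<in> {\<zeta>. cmod \<zeta> \<le> 1} \<longrightarrow> elog (cmod (z - \<zeta>)) = ereal (potential_kernel z \<zeta>)"
    using AE by eventually_elim (auto simp: elog_def potential_kernel_def)
  note 1 = ereal_set_integral_eq_integral[OF i(1) this]
  have "AE \<zeta> in \<mu>. \<zeta> \<in> {\<zeta>. cmod \<zeta> > 1} \<longrightarrow> elog (cmod (1 - z / \<zeta>)) = ereal (potential_kernel z \<zeta>)"
    using AE
  proof eventually_elim
    case (elim \<zeta>)
    show ?case
    proof
      assume "\<zeta> \<in> {\<zeta>. cmod \<zeta> > 1}"
      hence \<zeta>: "cmod \<zeta> > 1" "\<zeta> \<noteq> 0" by auto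
      hence "1 - z / \<zeta> = (\<zeta> - z) / \<zeta>" by (simp add: diff_divide_distrib)
      hence "cmod (1 - z / \<zeta>) = cmod (z - \<zeta>) / cmod \<zeta>" by (simp add: norm_divide norm_minus_commute)
      thus "elog (cmod (1 - z / \<zeta>)) = ereal (potential_kernel z \<zeta>)"
        using \<zeta> elim by (auto simp: elog_def potential_kernel_def ln_div divide_le_0_iff)
    qed
  qed
  note 2 = ereal_set_integral_eq_integral[OF i(2) this]
  have "(\<integral>\<zeta>. indicator {\<zeta>. cmod \<zeta> \<le> 1} \<zeta> * potential_kernel z \<zeta> \<partial>\<mu>)
      + (\<integral>\<zeta>. indicator {\<zeta>. cmod \<zeta> > 1} \<zeta> * potential_kernel z \<zeta> \<partial>\<mu>) = (\<integral>\<zeta>. potential_kernel z \<zeta> \<partial>\<mu>)"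
    unfolding Bochner_Integration.integral_add[OF i, symmetric]
    by (rule Bochner_Integration.integral_cong) (auto simp: indicator_def)
  thus ?thesis unfolding potential_def 1 2 by simp
qed

lemma elog_le: "elog x \<le> ereal x"
  using ln_le_minus_one[of x] by (auto simp: elog_def)

lemma potential_at_atom:
  assumes "finite_measure \<mu>" and sets: "sets \<mu> = sets borel"
    and atom: "emeasure \<mu> {z} \<noteq> 0" and z: "cmod z \<le> 1"
  shows "potential \<mu> z = - \<infinity>"
proof -
  interpret finite_measure \<mu> by fact
  \<comment> \<open>For \<open>cmod z \<le> 1\<close> the argument of \<open>elog\<close> is at most
    2 in both integrals, and \<open>elog x \<le> x\<close>.\<close>
  have bd: "(\<integral>\<^sup>+\<zeta>\<in>A. e2ennreal (f \<zeta>) \<partial>\<mu>) < \<infinity>" if "\<And>\<zeta>. \<zeta> \<in> A \<Longrightarrow> f \<zeta> \<le> ereal 2" for A f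
  proof -
    have "e2ennreal (f \<zeta>) * indicator A \<zeta> \<le> ennreal 2" for \<zeta>
      using e2ennreal_mono[OF that[of \<zeta>]] by (auto simp: indicator_def e2ennreal_ereal)
    hence "(\<integral>\<^sup>+\<zeta>\<in>A. e2ennreal (f \<zeta>) \<partial>\<mu>) \<le> (\<integral>\<^sup>+\<zeta>. ennreal 2 \<partial>\<mu>)"
      by (intro nn_integral_mono)
    also have "\<dots> = ennreal 2 * emeasure \<mu> (space \<mu>)" by (rule nn_integral_const)
    also have "\<dots> < \<infinity>" using emeasure_finite[of "space \<mu>"] by (auto simp: ennreal_mult_eq_top_iff less_top[symmetric])
    finally show ?thesis .
  qed
  have p1: "(\<integral>\<^sup>+\<zeta>\<in>{\<zeta>. cmod \<zeta> \<le> 1}. e2ennreal (elog (cmod (z - \<zeta>))) \<partial>\<mu>) < \<infinity>"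
  proof (rule bd)
    fix \<zeta> assume "\<zeta> \<in> {\<zeta>. cmod \<zeta> \<le> 1}"
    hence "cmod (z - \<zeta>) \<le> 2" using z norm_triangle_ineq4[of z \<zeta>] by simp
    thus "elog (cmod (z - \<zeta>)) \<le> ereal 2" using elog_le order_trans ereal_less_eq(3) by blast
  qed
  have p2: "(\<integral>\<^sup>+\<zeta>\<in>{\<zeta>. cmod \<zeta> > 1}. e2ennreal (elog (cmod (1 - z / \<zeta>))) \<partial>\<mu>) < \<infinity>"
  proof (rule bd)
    fix \<zeta> assume "\<zeta> \<in> {\<zeta>. cmod \<zeta> > 1}"
    hence "cmod (z / \<zeta>) \<le> 1" using z by (auto simp: norm_divide divide_le_eq_1)
    hence "cmod (1 - z / \<zeta>) \<le> 2" using norm_triangle_ineq4[of 1 "z / \<zeta>"] by simp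
    thus "elog (cmod (1 - z / \<zeta>)) \<le> ereal 2" using elog_le order_trans ereal_less_eq(3) by blast
  qed
  have "\<infinity> = (\<integral>\<^sup>+\<zeta>. \<infinity> * indicator {z} \<zeta> \<partial>\<mu>)"
    using atom sets by (subst nn_integral_cmult_indicator) (auto simp: ennreal_top_mult)
  also have "\<dots> \<le> (\<integral>\<^sup>+\<zeta>\<in>{\<zeta>. cmod \<zeta> \<le> 1}. e2ennreal (- elog (cmod (z - \<zeta>))) \<partial>\<mu>)"
    using z by (intro nn_integral_mono) (auto simp: elog_def indicator_def)
  finally have n1: "(\<integral>\<^sup>+\<zeta>\<in>{\<zeta>. cmod \<zeta> \<le> 1}. e2ennreal (- elog (cmod (z - \<zeta>))) \<partial>\<mu>) = \<infinity>"
    by (simp add: top_unique)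
  \<comment> \<open>The second summand may also be negative infinity; it suffices that it is not
    positive infinity.\<close>
  have diff: "enn2ereal a - enn2ereal b \<noteq> \<infinity>" if "a < \<infinity>" for a b
    using that by (cases a; cases b) (auto simp: enn2ereal_ennreal)
  have "enn2ereal a - enn2ereal \<infinity> = - \<infinity>" if "a < \<infinity>" for a
    using that by (cases a) (auto simp: enn2ereal_ennreal)
  with p1 diff[OF p2] n1 show ?thesis
    unfolding potential_def ereal_set_integral_def
    by simp
qed

text \<open>Conjugating \<open>z\<close> and \<open>\<zeta>\<close> together preserves the moduli,
  and the conjugated \<open>\<zeta>\<close> has the same distribution.\<close>

lemma potential_cnj:
  assumes sets: "sets \<mu> = sets borel" and sym: "distr \<mu> borel cnj = \<mu>"
  shows "potential \<mu> (cnj z) = potential \<mu> z"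
proof -
  have [measurable]: "cnj \<in> borel_measurable \<mu>"
    unfolding measurable_cong_sets[OF sets refl] by (intro borel_measurable_continuous_onI continuous_intros)
  have [measurable]: "elog \<in> borel_measurable borel" unfolding elog_def by measurable
  have eq: "(\<integral>\<^sup>+\<zeta>. f \<zeta> \<partial>\<mu>) = (\<integral>\<^sup>+\<zeta>. f (cnj \<zeta>) \<partial>\<mu>)" if [measurable]: "f \<in> borel_measurable borel" for f
    by (subst sym[symmetric], subst nn_integral_distr) auto
  have c: "cmod (cnj z - cnj \<zeta>) = cmod (z - \<zeta>)" "cmod (1 - cnj z / cnj \<zeta>) = cmod (1 - z / \<zeta>)" for \<zeta>
    by (metis complex_cnj_diff complex_mod_cnj) (metis complex_cnj_diff complex_cnj_divide complex_cnj_one complex_mod_cnj)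
  show ?thesis
    unfolding potential_def ereal_set_integral_def
    by (subst (1 2 3 4) eq) (simp_all add: c indicator_def)
qed

lemma (in pair_prob_space) integrable_comp_snd:
  fixes g :: "'b \<Rightarrow> real"
  assumes "integrable M2 g"
  shows "integrable (M1 \<Otimes>\<^sub>M M2) (\<lambda>p. g (snd p))"
proof (rule Fubini_integrable)
  have [measurable]: "g \<in> borel_measurable M2" using assms by simp
  show "(\<lambda>p. g (snd p)) \<in> borel_measurable (M1 \<Otimes>\<^sub>M M2)" by measurable
qed (use assms in auto)

lemma log_kernel_minus: "log_kernel (- u) \<tau> = log_kernel u \<tau>" "log_kernel u (- \<tau>) = log_kernel u \<tau>"
  by (simp_all add: log_kernel_def)

section \<open>The logistic function in a strip\<close>

locale sector =
  fixes \<alpha> :: real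
  assumes alpha: "0 < \<alpha>" "\<alpha> < pi / 2"
begin

definition \<rho> :: real where "\<rho> = pi / \<alpha>"

definition W :: "complex \<Rightarrow> complex" where
  "W w = exp (complex_of_real \<rho> * w) / (1 + exp (complex_of_real \<rho> * w))"

lemma rho: "\<rho> > 2" "\<rho> * \<alpha> = pi" "\<rho> \<noteq> 0"
  using alpha by (auto simp: \<rho>_def field_simps)

text \<open>All zeros are odd multiples of \<open>\<i> * \<alpha>\<close>; the strip retains only
  those with \<open>n = 0\<close> and \<open>n = -1\<close>.\<close>

lemma one_plus_exp_zeros:
  assumes "1 + exp (complex_of_real \<rho> * w) = 0" "\<bar>Im w\<bar> < 3 * \<alpha>"
  shows "w = \<i> * \<alpha> \<or> w = - \<i> * \<alpha>"
proof -
  have "exp (complex_of_real \<rho> * w) = exp (\<i> * pi)"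
    using assms(1) by (simp add: exp_pi_i' add_eq_0_iff)
  then obtain n :: int where n: "complex_of_real \<rho> * w = \<i> * pi + (of_int (2 * n) * pi) * \<i>"
    unfolding exp_eq by blast
  have re: "Re w = 0" using arg_cong[OF n, of Re] rho(3) by simp
  have "\<rho> * Im w = (1 + 2 * of_int n) * pi" using arg_cong[OF n, of Im] by (simp add: algebra_simps)
  hence "\<rho> * Im w = \<rho> * ((1 + 2 * of_int n) * \<alpha>)" by (simp flip: rho(2))
  hence im: "Im w = (1 + 2 * of_int n) * \<alpha>" using rho(3) by simp
  hence "\<bar>1 + 2 * of_int n :: real\<bar> * \<alpha> < 3 * \<alpha>" using assms(2) alpha by (simp add: abs_mult)
  hence "\<bar>1 + 2 * of_int n :: real\<bar> < 3" using alpha by simp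
  hence "n = 0 \<or> n = -1" by linarith
  thus ?thesis using re im by (auto simp: complex_eq_iff)
qed

lemma exp_rho_pole [simp]:
  "exp (complex_of_real \<rho> * (\<i> * \<alpha>)) = - 1" "exp (- (complex_of_real \<rho> * (\<i> * \<alpha>))) = - 1"
proof -
  have "complex_of_real \<rho> * (\<i> * \<alpha>) = \<i> * complex_of_real (\<rho> * \<alpha>)" by simp
  hence e: "complex_of_real \<rho> * (\<i> * \<alpha>) = \<i> * pi" by (simp only: rho)
  show "exp (complex_of_real \<rho> * (\<i> * \<alpha>)) = - 1" unfolding e by (rule exp_pi_i')
  show "exp (- (complex_of_real \<rho> * (\<i> * \<alpha>))) = - 1" unfolding e exp_minus by (simp add: exp_pi_i')
qed

text \<open>\<open>W\<close> has residue \<open>1 / \<rho>\<close> at each of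
  \<open>\<plusminus> \<i> * \<alpha>\<close>, and \<open>k\<close> has residue \<open>-1\<close> at
  \<open>z\<close>, which is enclosed exactly when \<open>t < 2 * \<alpha>\<close>. The condition
  \<open>z \<noteq> \<i> * \<alpha>\<close> keeps the poles simple.\<close>

lemma rectangle_integral:
  fixes k :: "complex \<Rightarrow> complex"
  assumes t: "0 < t" "t < pi" "t \<noteq> 2 * \<alpha>" and z: "z = Complex x t" "z \<noteq> \<i> * \<alpha>"
    and R: "R > \<bar>x\<bar>"
  defines "k \<equiv> (\<lambda>w :: complex. - 1 / (exp (w - z) - 1))"
  shows "contour_integral (rectpath (Complex (-R) (-2*\<alpha>)) (Complex R (2*\<alpha>))) (\<lambda>w. W w * k w)
     = 2 * pi * \<i> * ((if t < 2 * \<alpha> then - W z else 0) + (k (\<i> * \<alpha>) + k (- \<i> * \<alpha>)) / \<rho>)"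
proof -
  \<comment> \<open>Any height between \<open>2 * \<alpha>\<close> and \<open>m\<close> gives a
    strip that contains the rectangle but avoids \<open>\<plusminus> 3 * \<i> * \<alpha>\<close>,
    the translates of \<open>z\<close> by nonzero periods, and also \<open>z\<close> itself when it
    lies above the rectangle.\<close>
  define m where "m = min (3 * \<alpha>) (min (2 * pi - t) (if t < 2*\<alpha> then 3 * \<alpha> else t))"
  have "2 * \<alpha> < m" using alpha t by (auto simp: m_def)
  then obtain \<beta> where \<beta>: "2 * \<alpha> < \<beta>" "\<beta> < m" using dense by blast
  define S where "S = {w. \<bar>Im w\<bar> < \<beta>}"
  have S: "open S" "convex S"
  proof -
    have "S = {w. Im w < \<beta>} \<inter> {w. Im w > - \<beta>}" by (auto simp: S_def)
    thus "open S" "convex S"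
      by (auto intro!: open_Int open_halfspace_Im_lt open_halfspace_Im_gt convex_Int
         convex_halfspace_Im_lt convex_halfspace_Im_gt)
  qed
  define P where "P = {\<i> * \<alpha>, - \<i> * \<alpha>} \<union> (if t < 2 * \<alpha> then {z} else {})"
  have finP: "finite P" by (simp add: P_def)
  let ?a = "Complex (-R) (-2*\<alpha>)" and ?b = "Complex R (2*\<alpha>)"
  have Pbox: "P \<subseteq> box ?a ?b"
    using alpha t R z by (auto simp: P_def in_box_complex_iff split: if_splits)
  have cb: "cbox ?a ?b \<subseteq> S" using \<beta> by (auto simp: S_def in_cbox_complex_iff)
  have nz1: "1 + exp (complex_of_real \<rho> * w) \<noteq> 0" if "w \<in> S" "w \<notin> P" for w
    using that one_plus_exp_zeros[of w] \<beta> by (auto simp: S_def P_def m_def)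
  have nz2: "exp (w - z) - 1 \<noteq> 0" if "w \<in> S" "w \<notin> P" for w
  proof
    assume "exp (w - z) - 1 = 0"
    moreover have "\<bar>Im w - Im z\<bar> < 2 * pi"
      using that(1) \<beta> t by (auto simp: S_def m_def z abs_less_iff)
    ultimately have "w = z" using exp_minus_one_zeros[of w z] by simp
    thus False using that \<beta> t z by (auto simp: S_def P_def m_def split: if_splits)
  qed
  have holo: "(\<lambda>w. W w * k w) holomorphic_on S - P"
    unfolding W_def k_def using nz1 nz2 by (auto intro!: holomorphic_intros)
  have "contour_integral (rectpath ?a ?b) (\<lambda>w. W w * k w)
     = 2 * pi * \<i> * (\<Sum>p\<in>P. winding_number (rectpath ?a ?b) p * residue (\<lambda>w. W w * k w) p)"
  proof (rule Residue_theorem[OF S(1) convex_connected[OF S(2)] finP holo])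
    show "path_image (rectpath ?a ?b) \<subseteq> S - P"
      using path_image_rectpath_cbox_minus_box[of ?a ?b] cb Pbox alpha R by auto
    show "\<forall>w. w \<notin> S \<longrightarrow> winding_number (rectpath ?a ?b) w = 0"
      using cb alpha R by (auto intro!: winding_number_rectpath_outside)
  qed auto
  also have "(\<Sum>p\<in>P. winding_number (rectpath ?a ?b) p * residue (\<lambda>w. W w * k w) p)
     = (\<Sum>p\<in>P. residue (\<lambda>w. W w * k w) p)"
    using Pbox by (intro sum.cong) (auto simp: winding_number_rectpath)
  also have "\<dots> = (if t < 2 * \<alpha> then - W z else 0) + (k (\<i> * \<alpha>) + k (- \<i> * \<alpha>)) / \<rho>"
  proof -
    \<comment> \<open>On \<open>T\<close> the kernel \<open>k\<close> is holomorphic, so there only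
      the denominator of \<open>W\<close> vanishes.\<close>
    define T where "T = {w. exp (w - z) \<noteq> 1}"
    have T: "open T" unfolding T_def by (intro open_Collect_neq continuous_intros)
    have pole: "residue (\<lambda>w. W w * k w) p = k p / \<rho>" if p: "exp (complex_of_real \<rho> * p) = - 1" "p \<in> T" for p
    proof -
      have "residue (\<lambda>w. (exp (complex_of_real \<rho> * w) * k w) / (1 + exp (complex_of_real \<rho> * w))) p = (exp (complex_of_real \<rho> * p) * k p) / (complex_of_real \<rho> * exp (complex_of_real \<rho> * p))"
        using p rho T by (intro residue_divide_simple_zero[where S=T])
          (auto simp: T_def k_def intro!: holomorphic_intros derivative_eq_intros)
      thus ?thesis using p by (simp add: W_def)
    qed
    have zn: "\<bar>Im p - Im z\<bar> < 2 * pi" if "p = \<i> * \<alpha> \<or> p = - \<i> * \<alpha>" for p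
      using that alpha t z by auto
    have r1: "residue (\<lambda>w. W w * k w) (\<i> * \<alpha>) = k (\<i> * \<alpha>) / \<rho>"
      using exp_minus_one_zeros[of "\<i> * \<alpha>" z] zn[of "\<i> * \<alpha>"] z(2) by (intro pole) (auto simp: T_def)
    have r2: "residue (\<lambda>w. W w * k w) (- \<i> * \<alpha>) = k (- \<i> * \<alpha>) / \<rho>"
      using exp_minus_one_zeros[of "- \<i> * \<alpha>" z] zn[of "- \<i> * \<alpha>"] z t alpha
      by (intro pole) (auto simp: T_def complex_eq_iff)
    have r3: "residue (\<lambda>w. W w * k w) z = - W z" if "t < 2 * \<alpha>"
    proof -
      \<comment> \<open>Now the roles are exchanged: \<open>W\<close> is holomorphic on
        \<open>T'\<close>, and the kernel supplies the simple zero.\<close>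
      define T' where "T' = {w. 1 + exp (complex_of_real \<rho> * w) \<noteq> 0}"
      have T': "open T'" unfolding T'_def by (intro open_Collect_neq continuous_intros)
      have zT: "1 + exp (complex_of_real \<rho> * z) \<noteq> 0"
        using one_plus_exp_zeros[of z] that z t alpha by (auto simp: complex_eq_iff)
      have "residue (\<lambda>w. (- W w) / (exp (w - z) - 1)) z = (- W z) / 1"
        using T' zT by (intro residue_divide_simple_zero[where S=T'])
          (auto simp: T'_def W_def intro!: holomorphic_intros derivative_eq_intros)
      thus ?thesis by (simp add: k_def)
    qed
    have d: "\<i> * \<alpha> \<noteq> - \<i> * \<alpha>" "z \<noteq> - \<i> * \<alpha>" using alpha z t by (auto simp: complex_eq_iff)
    show ?thesis unfolding P_def using r1 r2 r3 d z(2)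
      by (auto simp: add_divide_distrib)
  qed
  finally show ?thesis .
qed

section \<open>The logistic function on the line and integration by parts\<close>

definition logistic :: "real \<Rightarrow> real" where
  "logistic y = exp (\<rho> * y) / (1 + exp (\<rho> * y))"

definition logistic_density :: "real \<Rightarrow> real" where
  "logistic_density y = \<rho> * exp (\<rho> * y) / (1 + exp (\<rho> * y))\<^sup>2"

lemma one_plus_exp_neq_0: "1 + exp t \<noteq> 0" for t :: real
  using exp_gt_zero[of t] by linarith

lemma has_derivative_logistic:
  "(logistic has_real_derivative logistic_density y) (at y within S)"
  unfolding logistic_def logistic_density_def
  by (auto intro!: derivative_eq_intros simp: one_plus_exp_neq_0 power2_eq_square field_simps)

lemma continuous_on_logistic_density [continuous_intros]: "continuous_on S logistic_density"
  unfolding logistic_density_def by (intro continuous_intros) (simp add: one_plus_exp_neq_0)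

text \<open>The shift \<open>\<rho> * s = \<plusminus> 2 * pi\<close> is a period of
  \<open>exp\<close>. Since \<open>W\<close> takes the same real values on both horizontal sides,
  only the difference of the kernels survives there.\<close>

lemma W_horizontal: "W (Complex y s) = logistic y" if "s = 2 * \<alpha> \<or> s = - 2 * \<alpha>"
proof -
  have "\<rho> * s = 2 * pi \<or> \<rho> * s = - (2 * pi)" using that rho(2) by auto
  hence "exp (complex_of_real \<rho> * Complex y s) = exp (complex_of_real (\<rho> * y))"
    by (auto simp: complex_eq_iff Re_exp Im_exp)
  thus ?thesis by (simp add: W_def logistic_def flip: exp_of_real)
qed

lemma has_derivative_log_kernel:
  assumes "cos \<tau> \<noteq> 1"
  shows "((\<lambda>y. log_kernel (y - x) \<tau>) has_real_derivative
     sinh (y - x) / (2 * (cosh (y - x) - cos \<tau>))) (at y within S)"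
proof -
  have "0 < cosh (y - x) - cos \<tau>" using assms by (simp only: cosh_minus_cos_pos_iff) simp
  thus ?thesis unfolding log_kernel_def
    by (auto intro!: derivative_eq_intros simp: field_simps)
qed

text \<open>Translation by \<open>Complex 0 s\<close> moves a segment of the real axis onto this
  one.\<close>

lemma has_contour_integral_linepath_same_Im:
  assumes "a < b" "f contour_integrable_on linepath (Complex a s) (Complex b s)"
  shows "((\<lambda>y. f (Complex y s)) has_integral
     contour_integral (linepath (Complex a s) (Complex b s)) f) {a..b}"
proof -
  define g where "g = (\<lambda>w. f (w + Complex 0 s))"
  have v: "linepath (Complex a s) (Complex b s) = (\<lambda>u. linepath (complex_of_real a) b u + Complex 0 s)"
    by (auto simp: linepath_def complex_eq_iff algebra_simps)
  have "(f has_contour_integral I) (linepath (Complex a s) (Complex b s)) \<longleftrightarrow>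
        (g has_contour_integral I) (linepath (complex_of_real a) b)" for I
    unfolding has_contour_integral_linepath g_def unfolding v by (simp add: complex_of_real_def complex_diff)
  hence "(g has_contour_integral contour_integral (linepath (Complex a s) (Complex b s)) f) (linepath (complex_of_real a) b)"
    using assms has_contour_integral_integral by blast
  hence "((\<lambda>y. g (of_real y)) has_integral contour_integral (linepath (Complex a s) (Complex b s)) f) {a..b}"
    using has_contour_integral_linepath_Reals_iff[of "of_real a" "of_real b"] assms by simp
  moreover have "of_real y + Complex 0 s = Complex y s" for y by (simp add: complex_eq_iff)
  ultimately show ?thesis by (simp add: g_def)
qed

text \<open>Integration by parts moves the derivative from \<open>logistic\<close> to
  \<open>F\<close>. Then \<open>logistic\<close> times the derivative of \<open>F\<close> is the
  real part of \<open>W w * k w\<close> on the lower side minus that on the upper side, and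
  \<open>rectangle_integral\<close> replaces its integral by residues and the two vertical
  sides.\<close>

lemma truncated_integral:
  fixes k :: "complex \<Rightarrow> complex" and x t R :: real
  assumes t: "0 < t" "t < pi" "t \<noteq> 2 * \<alpha>" and z: "z = Complex x t" "z \<noteq> \<i> * \<alpha>"
    and R: "R > \<bar>x\<bar>"
  defines "k \<equiv> (\<lambda>w :: complex. - 1 / (exp (w - z) - 1))"
    and "F \<equiv> (\<lambda>y. log_kernel (y - x) (t - 2 * \<alpha>) - log_kernel (y - x) (t + 2 * \<alpha>))"
    and "c \<equiv> (if t < 2 * \<alpha> then - W z else 0) + (k (\<i> * \<alpha>) + k (- \<i> * \<alpha>)) / \<rho>"
  shows "((\<lambda>y. logistic_density y * F y) has_integral
     (logistic R * F R - logistic (- R) * F (- R) - Re (2 * pi * \<i> * c)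
      + Re (contour_integral (linepath (Complex R (-2*\<alpha>)) (Complex R (2*\<alpha>))) (\<lambda>w. W w * k w)
          + contour_integral (linepath (Complex (-R) (2*\<alpha>)) (Complex (-R) (-2*\<alpha>))) (\<lambda>w. W w * k w)))) {-R..R}"
    and "(\<lambda>w. W w * k w) contour_integrable_on linepath (Complex R (-2*\<alpha>)) (Complex R (2*\<alpha>))"
    and "(\<lambda>w. W w * k w) contour_integrable_on linepath (Complex (-R) (2*\<alpha>)) (Complex (-R) (-2*\<alpha>))"
proof -
  let ?f = "\<lambda>w. W w * k w" and ?a = "Complex (-R) (-2*\<alpha>)" and ?b = "Complex R (2*\<alpha>)"
  have t4: "- (2 * pi) < t - 2 * \<alpha>" "t - 2 * \<alpha> < 2 * pi" "0 < t + 2 * \<alpha>" "t + 2 * \<alpha> < 2 * pi"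
    using t alpha by auto
  have cosa: "cos (t - 2 * \<alpha>) \<noteq> 1" "cos (t + 2 * \<alpha>) \<noteq> 1"
  proof -
    have "\<bar>t - 2 * \<alpha>\<bar> < 2 * pi" "\<bar>t + 2 * \<alpha>\<bar> < 2 * pi" using t4 by linarith+
    thus "cos (t - 2 * \<alpha>) \<noteq> 1" "cos (t + 2 * \<alpha>) \<noteq> 1"
      using t4 t cos_eq_1_imp_zero[of "t - 2 * \<alpha>"] cos_eq_1_imp_zero[of "t + 2 * \<alpha>"] by auto
  qed
  have path: "Re w = R \<or> Re w = -R \<or> Im w = 2 * \<alpha> \<or> Im w = - 2 * \<alpha>" "\<bar>Im w\<bar> \<le> 2 * \<alpha>"
    if "w \<in> path_image (rectpath ?a ?b)" for w
    using that R alpha by (auto simp: path_image_rectpath)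
  have nz1: "1 + exp (complex_of_real \<rho> * w) \<noteq> 0" if "w \<in> path_image (rectpath ?a ?b)" for w
    using path[OF that] one_plus_exp_zeros[of w] alpha R by (auto simp: complex_eq_iff)
  have nz2: "exp (w - z) \<noteq> 1" if "w \<in> path_image (rectpath ?a ?b)" for w
  proof
    assume "exp (w - z) = 1"
    moreover have "\<bar>Im w - Im z\<bar> < 2 * pi" using path(2)[OF that] t alpha z by auto
    ultimately have "w = z" by (rule exp_minus_one_zeros)
    thus False using path[OF that] t z R alpha by auto
  qed
  have sub: "closed_segment ?a (Complex R (-2*\<alpha>)) \<union> closed_segment (Complex R (-2*\<alpha>)) ?b \<union>
     closed_segment ?b (Complex (-R) (2*\<alpha>)) \<union> closed_segment (Complex (-R) (2*\<alpha>)) ?a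
     \<subseteq> path_image (rectpath ?a ?b)"
    unfolding rectpath_def Let_def by (auto simp: path_image_join)
  have cont: "continuous_on (path_image (rectpath ?a ?b)) ?f"
    unfolding W_def k_def using nz1 nz2 by (intro continuous_intros) auto
  have int: "?f contour_integrable_on linepath p q"
    if "closed_segment p q \<subseteq> path_image (rectpath ?a ?b)" for p q
    using cont that by (intro contour_integrable_continuous_linepath) (rule continuous_on_subset)
  note i = int[of ?a "Complex R (-2*\<alpha>)"] int[of "Complex R (-2*\<alpha>)" ?b]
    int[of ?b "Complex (-R) (2*\<alpha>)"] int[of "Complex (-R) (2*\<alpha>)" ?a]
  have i1: "?f contour_integrable_on linepath ?a (Complex R (-2*\<alpha>))" using i(1) sub by blast
  show i2: "?f contour_integrable_on linepath (Complex R (-2*\<alpha>)) ?b" using i(2) sub by blast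
  have i3: "?f contour_integrable_on linepath ?b (Complex (-R) (2*\<alpha>))" using i(3) sub by blast
  show i4: "?f contour_integrable_on linepath (Complex (-R) (2*\<alpha>)) ?a" using i(4) sub by blast
  let ?I2 = "contour_integral (linepath (Complex R (-2*\<alpha>)) ?b) ?f"
  let ?I4 = "contour_integral (linepath (Complex (-R) (2*\<alpha>)) ?a) ?f"
  \<comment> \<open>The rectangle traverses its upper side from right to left; reversing it lets
    both horizontal integrals run over increasing \<open>y\<close>.\<close>
  have i3': "?f contour_integrable_on linepath (Complex (-R) (2*\<alpha>)) ?b"
    using i3 by (metis contour_integrable_reversepath_eq reversepath_linepath valid_path_linepath)
  have "2 * pi * \<i> * c = contour_integral (rectpath ?a ?b) ?f"
    unfolding c_def k_def by (rule rectangle_integral[OF t z R, symmetric])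
  also have "\<dots> = contour_integral (linepath ?a (Complex R (-2*\<alpha>))) ?f + ?I2
      - contour_integral (linepath (Complex (-R) (2*\<alpha>)) ?b) ?f + ?I4"
    using i1 i2 i3 i4 contour_integral_reverse_linepath[of ?b "Complex (-R) (2*\<alpha>)" ?f] cont sub
    by (simp add: rectpath_def Let_def contour_integral_reverse_linepath continuous_on_subset)
  finally have res: "contour_integral (linepath ?a (Complex R (-2*\<alpha>))) ?f
     - contour_integral (linepath (Complex (-R) (2*\<alpha>)) ?b) ?f = 2 * pi * \<i> * c - ?I2 - ?I4"
    by (simp add: algebra_simps)
  have RR: "- R < R" using R by linarith
  have "((\<lambda>y. Re (?f (Complex y (-2*\<alpha>)) - ?f (Complex y (2*\<alpha>)))) has_integral
     Re (2 * pi * \<i> * c - ?I2 - ?I4)) {-R..R}"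
    unfolding res[symmetric]
    by (intro has_integral_Re has_integral_diff has_contour_integral_linepath_same_Im RR i1 i3')
  also have "(\<lambda>y. Re (?f (Complex y (-2*\<alpha>)) - ?f (Complex y (2*\<alpha>)))) =
     (\<lambda>y. logistic y * (sinh (y - x) / (2 * (cosh (y - x) - cos (t - 2 * \<alpha>)))
                   - sinh (y - x) / (2 * (cosh (y - x) - cos (t + 2 * \<alpha>)))))" (is "_ = (\<lambda>y. logistic y * ?F' y)")
  proof
    fix y
    have zz: "Complex y s - z = Complex (y - x) (s - t)" for s by (simp add: z complex_eq_iff)
    have c1: "cos (- 2 * \<alpha> - t) = cos (t + 2 * \<alpha>)" "cos (2 * \<alpha> - t) = cos (t - 2 * \<alpha>)"
    proof -
      have "- 2 * \<alpha> - t = - (t + 2 * \<alpha>)" "2 * \<alpha> - t = - (t - 2 * \<alpha>)" by simp_all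
      thus "cos (- 2 * \<alpha> - t) = cos (t + 2 * \<alpha>)" "cos (2 * \<alpha> - t) = cos (t - 2 * \<alpha>)"
        by (simp_all only: cos_minus)
    qed
    \<comment> \<open>The constant \<open>1/2\<close> is the same on both sides and cancels in the
      difference.\<close>
    have "Re (k (Complex y s)) = 1/2 - sinh (y - x) / (2 * (cosh (y - x) - cos b))"
      if "cos (s - t) = cos b" "cos b \<noteq> 1" for s b
      unfolding k_def zz using that by (subst minus_inverse_exp_minus_one) simp_all
    note k = this[OF c1(1) cosa(2)] this[OF c1(2) cosa(1)]
    show "Re (?f (Complex y (-2*\<alpha>)) - ?f (Complex y (2*\<alpha>))) = logistic y * ?F' y"
    proof -
      have "Re (?f (Complex y (-2*\<alpha>)) - ?f (Complex y (2*\<alpha>)))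
          = logistic y * (Re (k (Complex y (-2*\<alpha>))) - Re (k (Complex y (2*\<alpha>))))"
        using W_horizontal[of "-2*\<alpha>" y] W_horizontal[of "2*\<alpha>" y] by (simp add: right_diff_distrib)
      thus ?thesis unfolding k by simp
    qed
  qed
  finally have WF': "((\<lambda>y. logistic y * ?F' y) has_integral Re (2 * pi * \<i> * c - ?I2 - ?I4)) {-R..R}" .
  have "((\<lambda>y. logistic_density y * F y + logistic y * ?F' y) has_integral
     (logistic R * F R - logistic (- R) * F (- R))) {-R..R}"
  proof (rule fundamental_theorem_of_calculus)
    fix y
    show "((\<lambda>y. logistic y * F y) has_vector_derivative
       logistic_density y * F y + logistic y * ?F' y) (at y within {-R..R})"
      unfolding has_real_derivative_iff_has_vector_derivative[symmetric] F_def
      by (rule derivative_eq_intros has_derivative_logistic has_derivative_log_kernel cosa refl)+ simp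
  qed (use R in auto)
  from has_integral_diff[OF this WF'] show "((\<lambda>y. logistic_density y * F y) has_integral
     (logistic R * F R - logistic (- R) * F (- R) - Re (2 * pi * \<i> * c) + Re (?I2 + ?I4))) {-R..R}"
    by (simp add: algebra_simps)
qed

section \<open>Decay of the logistic density\<close>

lemma logistic_density_pos: "0 < logistic_density y"
  using rho(1) unfolding logistic_density_def
  by (intro divide_pos_pos mult_pos_pos zero_less_power) (auto simp: add_pos_pos)

text \<open>The squared denominator is at least \<open>exp (2 * \<rho> * y)\<close>, used for
  \<open>y \<ge> 0\<close>, and at least 1, used for \<open>y < 0\<close>.\<close>

lemma logistic_density_le: "logistic_density y \<le> \<rho> * exp (- \<rho> * \<bar>y\<bar>)"
proof -
  have r: "\<rho> > 0" using rho(1) by simp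
  have "exp (\<rho> * y) / (1 + exp (\<rho> * y))\<^sup>2 \<le> exp (- \<rho> * \<bar>y\<bar>)"
  proof (cases "y \<ge> 0")
    case True
    have "(exp (\<rho> * y))\<^sup>2 \<le> (1 + exp (\<rho> * y))\<^sup>2" by (intro power_mono) auto
    hence "exp (\<rho> * y) / (1 + exp (\<rho> * y))\<^sup>2 \<le> exp (\<rho> * y) / (exp (\<rho> * y))\<^sup>2"
      by (intro divide_left_mono mult_pos_pos zero_less_power add_pos_pos exp_gt_zero) auto
    also have "\<dots> = exp (- \<rho> * \<bar>y\<bar>)" using True by (simp add: power2_eq_square exp_minus field_simps)
    finally show ?thesis .
  next
    case False
    have "(1::real)\<^sup>2 \<le> (1 + exp (\<rho> * y))\<^sup>2" by (intro power_mono) auto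
    hence "exp (\<rho> * y) / (1 + exp (\<rho> * y))\<^sup>2 \<le> exp (\<rho> * y) / 1"
      by (intro divide_left_mono mult_pos_pos zero_less_power add_pos_pos exp_gt_zero) auto
    thus ?thesis using False by simp
  qed
  hence "\<rho> * (exp (\<rho> * y) / (1 + exp (\<rho> * y))\<^sup>2) \<le> \<rho> * exp (- \<rho> * \<bar>y\<bar>)"
    using r by (intro mult_left_mono) auto
  thus ?thesis by (simp add: logistic_density_def)
qed

lemma borel_measurable_logistic_density [measurable]:
  "logistic_density \<in> borel_measurable borel"
  by (intro borel_measurable_continuous_onI continuous_intros)

text \<open>Half of the exponential decay absorbs the factor \<open>\<bar>y\<bar>\<close>.\<close>

lemma integrable_logistic_density_abs: "integrable lborel (\<lambda>y. logistic_density y * \<bar>y\<bar>)"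
proof -
  have "integrable lborel (\<lambda>y::real. 2 * exp (- (\<rho> / 2) * \<bar>y\<bar>))"
    using rho(1) by (intro integrable_mult_right integrable_exp_minus_abs) simp
  thus ?thesis
  proof (rule Bochner_Integration.integrable_bound)
    show "AE y in lborel. norm (logistic_density y * \<bar>y\<bar>) \<le> norm (2 * exp (- (\<rho> / 2) * \<bar>y\<bar>))"
    proof (rule AE_I2)
      fix y :: real
      have "\<rho> / 2 * \<bar>y\<bar> \<le> exp (\<rho> / 2 * \<bar>y\<bar>)" using exp_ge_add_one_self[of "\<rho> / 2 * \<bar>y\<bar>"] by linarith
      hence "exp (- \<rho> * \<bar>y\<bar>) * (\<rho> * \<bar>y\<bar>) \<le> exp (- \<rho> * \<bar>y\<bar>) * (2 * exp (\<rho> / 2 * \<bar>y\<bar>))"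
        by (intro mult_left_mono) auto
      also have "\<dots> = 2 * exp (- (\<rho> / 2) * \<bar>y\<bar>)"
        by (simp add: mult_exp_exp field_simps)
      finally have "\<rho> * exp (- \<rho> * \<bar>y\<bar>) * \<bar>y\<bar> \<le> 2 * exp (- (\<rho> / 2) * \<bar>y\<bar>)" by (simp add: mult_ac)
      moreover have "logistic_density y * \<bar>y\<bar> \<le> \<rho> * exp (- \<rho> * \<bar>y\<bar>) * \<bar>y\<bar>"
        by (intro mult_right_mono logistic_density_le) auto
      ultimately have "logistic_density y * \<bar>y\<bar> \<le> 2 * exp (- (\<rho> / 2) * \<bar>y\<bar>)" by linarith
      thus "norm (logistic_density y * \<bar>y\<bar>) \<le> norm (2 * exp (- (\<rho> / 2) * \<bar>y\<bar>))"
        using logistic_density_pos[of y] by (simp add: abs_mult)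
    qed
  qed auto
qed

lemma integrable_logistic_density: "integrable lborel logistic_density"
proof -
  have "integrable lborel (\<lambda>y::real. \<rho> * exp (- \<rho> * \<bar>y\<bar>))"
    using rho(1) by (intro integrable_mult_right integrable_exp_minus_abs) simp
  thus ?thesis
    by (rule Bochner_Integration.integrable_bound)
      (use logistic_density_le logistic_density_pos rho(1) in \<open>auto simp: less_imp_le abs_mult\<close>)
qed

text \<open>The singularity at \<open>y = x\<close> is majorized by a translated inverse square root
  times \<open>\<rho>\<close>, a bound for the density; the remaining linear growth is covered by
  the first absolute moment.\<close>

lemma integrable_density_log_kernel_bound:
  "integrable lborel (\<lambda>y. logistic_density y * log_kernel_bound (y - x))"
proof -
  define g where "g = (\<lambda>u::real. indicator {-1..1} u / sqrt \<bar>u\<bar>)"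
  have [measurable]: "g \<in> borel_measurable borel" unfolding g_def by measurable
  have "integrable lborel (\<lambda>y. g (-x + 1 * y))"
    by (rule lborel_integrable_real_affine[OF integrable_inverse_sqrt[folded g_def]]) simp
  hence "integrable lborel (\<lambda>y. logistic_density y * (ln 2 + 2 * \<bar>x\<bar>)
     + 2 * (logistic_density y * \<bar>y\<bar>) + 2 * \<rho> * g (y - x))"
    by (intro Bochner_Integration.integrable_add integrable_mult_left integrable_mult_right
        integrable_logistic_density integrable_logistic_density_abs) simp_all
  thus ?thesis
  proof (rule Bochner_Integration.integrable_bound)
    show "AE y in lborel. norm (logistic_density y * log_kernel_bound (y - x))
      \<le> norm (logistic_density y * (ln 2 + 2 * \<bar>x\<bar>) + 2 * (logistic_density y * \<bar>y\<bar>) + 2 * \<rho> * g (y - x))"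
    proof (rule AE_I2)
      fix y
      let ?d = "logistic_density y"
      have g0: "0 \<le> g (y - x)" by (simp add: g_def)
      have d0: "0 \<le> ?d" using logistic_density_pos[of y] by simp
      have "?d \<le> \<rho> * 1"
        by (rule order_trans[OF logistic_density_le]) (use rho(1) in \<open>auto intro!: mult_left_mono\<close>)
      hence dg: "?d * g (y - x) \<le> \<rho> * g (y - x)" using g0 by (intro mult_right_mono) auto
      have "log_kernel_bound (y - x) \<le> (ln 2 + 2 * \<bar>x\<bar>) + 2 * \<bar>y\<bar> + 2 * g (y - x)"
        using abs_ln_abs_le[of "y - x"] unfolding log_kernel_bound_def g_def by linarith
      hence "?d * log_kernel_bound (y - x) \<le> ?d * ((ln 2 + 2 * \<bar>x\<bar>) + 2 * \<bar>y\<bar> + 2 * g (y - x))"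
        using d0 by (intro mult_left_mono)
      also have "\<dots> = ?d * (ln 2 + 2 * \<bar>x\<bar>) + 2 * (?d * \<bar>y\<bar>) + 2 * (?d * g (y - x))"
        by (simp add: algebra_simps)
      also have "\<dots> \<le> ?d * (ln 2 + 2 * \<bar>x\<bar>) + 2 * (?d * \<bar>y\<bar>) + 2 * \<rho> * g (y - x)"
        using dg by simp
      finally have le: "?d * log_kernel_bound (y - x) \<le> ?d * (ln 2 + 2 * \<bar>x\<bar>) + 2 * (?d * \<bar>y\<bar>) + 2 * \<rho> * g (y - x)" .
      have "0 \<le> log_kernel_bound (y - x)" by (simp add: log_kernel_bound_def)
      hence "0 \<le> ?d * log_kernel_bound (y - x)" using d0 by simp
      thus "norm (?d * log_kernel_bound (y - x))
        \<le> norm (?d * (ln 2 + 2 * \<bar>x\<bar>) + 2 * (?d * \<bar>y\<bar>) + 2 * \<rho> * g (y - x))"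
        using le by simp
    qed
  qed (auto simp: log_kernel_bound_def)
qed

lemma AE_density_log_kernel_le:
  "AE y in lborel. norm (logistic_density y * log_kernel (y - x) \<tau>) \<le> logistic_density y * log_kernel_bound (y - x)"
  using AE_lborel_singleton[of x]
proof eventually_elim
  case (elim y)
  thus ?case using abs_log_kernel_le[of "y - x" \<tau>] logistic_density_pos[of y]
    by (auto simp: abs_mult)
qed

lemma integrable_density_log_kernel:
  "integrable lborel (\<lambda>y. logistic_density y * log_kernel (y - x) \<tau>)"
proof (rule Bochner_Integration.integrable_bound[OF integrable_density_log_kernel_bound[of x]])
  show "AE y in lborel. norm (logistic_density y * log_kernel (y - x) \<tau>)
     \<le> norm (logistic_density y * log_kernel_bound (y - x))"
    using AE_density_log_kernel_le[of x \<tau>] by eventually_elim (auto intro: order_trans)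
qed auto

subsection \<open>The potential of a ray\<close>

text \<open>Up to a term independent of \<open>\<tau>\<close>, this is the logarithmic potential at
  \<open>exp (Complex x \<tau>)\<close> of the logistic distribution placed on the positive ray by
  \<open>y \<mapsto> exp y\<close>.\<close>

definition ray_potential :: "real \<Rightarrow> real \<Rightarrow> real" where
  "ray_potential x \<tau> = (\<integral>y. logistic_density y * log_kernel (y - x) \<tau> \<partial>lborel)"

text \<open>The majorant is free of the angle, so dominated convergence works even at angles where
  the point lies on the ray.\<close>

lemma continuous_on_ray_potential: "continuous_on S (ray_potential x)"
proof (rule continuous_on_subset[OF _ subset_UNIV], unfold continuous_on_sequentially comp_def, intro allI ballI impI)
  fix \<tau> :: "nat \<Rightarrow> real" and \<sigma> :: real
  assume "(\<forall>n. \<tau> n \<in> UNIV) \<and> \<tau> \<longlonglongrightarrow> \<sigma>"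
  hence lim: "\<tau> \<longlonglongrightarrow> \<sigma>" by simp
  show "(\<lambda>n. ray_potential x (\<tau> n)) \<longlonglongrightarrow> ray_potential x \<sigma>"
    unfolding ray_potential_def
  proof (rule integral_dominated_convergence[OF _ _ integrable_density_log_kernel_bound[of x]])
    show "AE y in lborel. (\<lambda>n. logistic_density y * log_kernel (y - x) (\<tau> n))
       \<longlonglongrightarrow> logistic_density y * log_kernel (y - x) \<sigma>"
      using AE_lborel_singleton[of x]
    proof eventually_elim
      case (elim y)
      hence "0 < cosh (y - x) - cos \<sigma>" by (simp only: cosh_minus_cos_pos_iff) simp
      thus ?case unfolding log_kernel_def using lim by (intro tendsto_intros) auto
    qed
    show "AE y in lborel. norm (logistic_density y * log_kernel (y - x) (\<tau> n))
       \<le> logistic_density y * log_kernel_bound (y - x)" for n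
      by (rule AE_density_log_kernel_le)
  qed auto
qed

lemma ray_potential_periodic: "ray_potential x (\<tau> + 2 * pi) = ray_potential x \<tau>"
  by (simp add: ray_potential_def log_kernel_def)

lemma norm_W_bounds:
  assumes "R > 0"
  shows "Re w = R \<Longrightarrow> cmod (W w) \<le> exp (\<rho> * R) / (exp (\<rho> * R) - 1)"
    and "Re w = - R \<Longrightarrow> cmod (W w) \<le> exp (- \<rho> * R) / (1 - exp (- \<rho> * R))"
proof -
  have r: "\<rho> * R > 0" using rho(1) assms by simp
  let ?e = "exp (complex_of_real \<rho> * w)"
  { assume w: "Re w = R"
    have n: "cmod ?e = exp (\<rho> * R)" using w by simp
    have "exp (\<rho> * R) - 1 \<le> cmod (1 + ?e)" using norm_diff_ineq[of ?e 1] unfolding n by (simp add: add.commute)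
    moreover have "0 < exp (\<rho> * R) - 1" using r by simp
    ultimately show "cmod (W w) \<le> exp (\<rho> * R) / (exp (\<rho> * R) - 1)"
      unfolding W_def norm_divide n by (intro divide_left_mono mult_pos_pos) auto }
  { assume w: "Re w = - R"
    have n: "cmod ?e = exp (- \<rho> * R)" using w by simp
    have "1 - exp (- \<rho> * R) \<le> cmod (1 + ?e)" using norm_diff_ineq[of 1 ?e] unfolding n by simp
    moreover have "0 < 1 - exp (- \<rho> * R)" using r by simp
    ultimately show "cmod (W w) \<le> exp (- \<rho> * R) / (1 - exp (- \<rho> * R))"
      unfolding W_def norm_divide n by (intro divide_left_mono mult_pos_pos) auto }
qed

text \<open>As \<open>R\<close> tends to infinity in \<open>truncated_integral\<close>, only
  \<open>- Re (2 * pi * \<i> * c) = 2 * pi * Im c\<close> remains. The sine quotients come from the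
  kernel at \<open>\<plusminus> \<i> * \<alpha>\<close>, and the \<open>W\<close> term from the pole
  at \<open>Complex x t\<close>.\<close>

lemma ray_potential_diff:
  fixes x t :: real
  assumes t: "0 < t" "t < pi" "t \<noteq> 2 * \<alpha>" and z: "Complex x t \<noteq> \<i> * \<alpha>"
  shows "ray_potential x (t - 2 * \<alpha>) - ray_potential x (t + 2 * \<alpha>) =
    - 2 * pi * (if t < 2 * \<alpha> then Im (W (Complex x t)) else 0)
    - pi / \<rho> * (sin (t - \<alpha>) / (cosh x - cos (t - \<alpha>)) + sin (t + \<alpha>) / (cosh x - cos (t + \<alpha>)))"
proof -
  define k :: "complex \<Rightarrow> complex" where "k = (\<lambda>w. - 1 / (exp (w - Complex x t) - 1))"
  define F where "F = (\<lambda>y. log_kernel (y - x) (t - 2 * \<alpha>) - log_kernel (y - x) (t + 2 * \<alpha>))"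
  define c where "c = (if t < 2 * \<alpha> then - W (Complex x t) else 0) + (k (\<i> * \<alpha>) + k (- \<i> * \<alpha>)) / \<rho>"
  define I2 where "I2 = (\<lambda>R. contour_integral (linepath (Complex R (-2*\<alpha>)) (Complex R (2*\<alpha>))) (\<lambda>w. W w * k w))"
  define I4 where "I4 = (\<lambda>R. contour_integral (linepath (Complex (-R) (2*\<alpha>)) (Complex (-R) (-2*\<alpha>))) (\<lambda>w. W w * k w))"
  note trunc = truncated_integral[OF t refl z]
  have logistic01: "\<bar>logistic y\<bar> \<le> 1" for y
    using exp_gt_zero[of "\<rho> * y"] by (simp add: logistic_def abs_of_pos add_pos_pos)
  have null: "((\<lambda>R. l R * G R) \<longlongrightarrow> 0) at_top"
    if "(G \<longlongrightarrow> 0) at_top" "\<And>R. \<bar>l R\<bar> \<le> 1" for l G :: "real \<Rightarrow> real"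
    by (rule Lim_null_comparison[OF always_eventually tendsto_rabs_zero[OF that(1)]])
      (use that(2) in \<open>auto simp: abs_mult intro: mult_left_le_one_le\<close>)
  have nk: "cmod (k w) = 1 / cmod (exp (w - Complex x t) - 1)" for w
    by (simp add: k_def norm_divide)
  have ev: "eventually (\<lambda>R. R > max \<bar>x\<bar> 0) at_top" by (rule eventually_gt_at_top)
  have len: "cmod (Complex R (2*\<alpha>) - Complex R (-2*\<alpha>)) = 4 * \<alpha>"
       "cmod (Complex R (-2*\<alpha>) - Complex R (2*\<alpha>)) = 4 * \<alpha>" for R
  proof -
    have "Complex R (2*\<alpha>) - Complex R (-2*\<alpha>) = \<i> * complex_of_real (4 * \<alpha>)"
         "Complex R (-2*\<alpha>) - Complex R (2*\<alpha>) = \<i> * complex_of_real (- 4 * \<alpha>)"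
      by (simp_all add: complex_eq_iff)
    thus "cmod (Complex R (2*\<alpha>) - Complex R (-2*\<alpha>)) = 4 * \<alpha>"
       "cmod (Complex R (-2*\<alpha>) - Complex R (2*\<alpha>)) = 4 * \<alpha>"
      using alpha by (simp_all only: norm_mult norm_of_real norm_ii)
  qed
  have "(I2 \<longlongrightarrow> 0) at_top"
  proof (rule Lim_null_comparison)
    show "eventually (\<lambda>R. norm (I2 R) \<le> exp (\<rho> * R) / (exp (\<rho> * R) - 1) * (1 / (exp (R - x) - 1)) * (4 * \<alpha>)) at_top"
      using ev
    proof eventually_elim
      case (elim R)
      have R: "R > 0" "exp (R - x) > 1" "exp (\<rho> * R) > 1" using elim rho(1) by auto
      show ?case unfolding I2_def
      proof (subst len(1)[symmetric, of R], rule contour_integral_bound_linepath)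
        show "(\<lambda>w. W w * k w) contour_integrable_on linepath (Complex R (-2*\<alpha>)) (Complex R (2*\<alpha>))"
          using trunc(2)[of R] elim by (simp add: k_def)
        fix w assume "w \<in> closed_segment (Complex R (-2*\<alpha>)) (Complex R (2*\<alpha>))"
        hence w: "Re w = R" by (subst (asm) closed_segment_same_Re) auto
        have n: "cmod (exp (w - Complex x t)) = exp (R - x)" using w by simp
        have "exp (R - x) - 1 \<le> cmod (exp (w - Complex x t) - 1)"
          using norm_triangle_ineq2[of "exp (w - Complex x t)" 1] n by simp
        hence "cmod (k w) \<le> 1 / (exp (R - x) - 1)"
          unfolding nk using R by (intro divide_left_mono mult_pos_pos) auto
        thus "norm (W w * k w) \<le> exp (\<rho> * R) / (exp (\<rho> * R) - 1) * (1 / (exp (R - x) - 1))"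
          unfolding norm_mult using norm_W_bounds(1)[OF R(1) w] R by (intro mult_mono) auto
      qed (use R in auto)
    qed
    show "((\<lambda>R. exp (\<rho> * R) / (exp (\<rho> * R) - 1) * (1 / (exp (R - x) - 1)) * (4 * \<alpha>)) \<longlongrightarrow> 0) at_top"
      using tendsto_mult_right[OF vertical_bounds_tendsto(1)[of \<rho> x], of "4 * \<alpha>"] rho(1) by simp
  qed
  moreover have "(I4 \<longlongrightarrow> 0) at_top"
  proof (rule Lim_null_comparison)
    show "eventually (\<lambda>R. norm (I4 R) \<le> exp (- \<rho> * R) / (1 - exp (- \<rho> * R)) * (1 / (1 - exp (- R - x))) * (4 * \<alpha>)) at_top"
      using ev
    proof eventually_elim
      case (elim R)
      have R: "R > 0" "exp (- R - x) < 1" "exp (- \<rho> * R) < 1" using elim rho(1) by auto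
      show ?case unfolding I4_def
      proof (subst len(2)[symmetric, of "- R"], rule contour_integral_bound_linepath)
        show "(\<lambda>w. W w * k w) contour_integrable_on linepath (Complex (-R) (2*\<alpha>)) (Complex (-R) (-2*\<alpha>))"
          using trunc(3)[of R] elim by (simp add: k_def)
        fix w assume "w \<in> closed_segment (Complex (-R) (2*\<alpha>)) (Complex (-R) (-2*\<alpha>))"
        hence w: "Re w = - R" by (subst (asm) closed_segment_same_Re) auto
        have n: "cmod (exp (w - Complex x t)) = exp (- R - x)" using w by simp
        have "1 - exp (- R - x) \<le> cmod (exp (w - Complex x t) - 1)"
          using norm_triangle_ineq2[of 1 "exp (w - Complex x t)"] n by (simp add: norm_minus_commute)
        hence "cmod (k w) \<le> 1 / (1 - exp (- R - x))"
          unfolding nk using R by (intro divide_left_mono mult_pos_pos) auto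
        thus "norm (W w * k w) \<le> exp (- \<rho> * R) / (1 - exp (- \<rho> * R)) * (1 / (1 - exp (- R - x)))"
          unfolding norm_mult using norm_W_bounds(2)[OF R(1) w] R by (intro mult_mono) auto
      qed (use R in auto)
    qed
    show "((\<lambda>R. exp (- \<rho> * R) / (1 - exp (- \<rho> * R)) * (1 / (1 - exp (- R - x))) * (4 * \<alpha>)) \<longlongrightarrow> 0) at_top"
      using tendsto_mult_right[OF vertical_bounds_tendsto(2)[of \<rho> x], of "4 * \<alpha>"] rho(1) by simp
  qed
  moreover have "((\<lambda>R. logistic R * F R) \<longlongrightarrow> 0) at_top" "((\<lambda>R. logistic (- R) * F (- R)) \<longlongrightarrow> 0) at_top"
    unfolding F_def by (intro null log_kernel_diff_tendsto logistic01)+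
  ultimately have lim: "((\<lambda>R. logistic R * F R - logistic (- R) * F (- R) - Re (2 * pi * \<i> * c) + Re (I2 R + I4 R))
     \<longlongrightarrow> 0 - 0 - Re (2 * pi * \<i> * c) + Re (0 + 0)) at_top"
    by (intro tendsto_intros)
  have int: "integrable lborel (\<lambda>y. logistic_density y * F y)"
    unfolding F_def right_diff_distrib
    by (intro Bochner_Integration.integrable_diff integrable_density_log_kernel)
  have "ray_potential x (t - 2 * \<alpha>) - ray_potential x (t + 2 * \<alpha>) = (\<integral>y. logistic_density y * F y \<partial>lborel)"
    unfolding ray_potential_def F_def right_diff_distrib
    by (subst Bochner_Integration.integral_diff) (rule integrable_density_log_kernel refl)+
  also have "\<dots> = 0 - 0 - Re (2 * pi * \<i> * c) + Re (0 + 0)"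
    using trunc(1) by (intro tendsto_integral_symmetric_interval[OF int _ lim]
       eventually_mono[OF eventually_gt_at_top[of "\<bar>x\<bar>"]])
       (auto simp: k_def F_def c_def I2_def I4_def)
  also have "\<dots> = 2 * pi * Im c" by simp
  also have "Im c = - (if t < 2 * \<alpha> then Im (W (Complex x t)) else 0) + (Im (k (\<i> * \<alpha>)) + Im (k (- \<i> * \<alpha>))) / \<rho>"
    by (simp add: c_def)
  also have "Im (k (\<i> * \<alpha>)) = - (sin (t - \<alpha>) / (cosh x - cos (t - \<alpha>))) / 2"
  proof -
    define v where "v = t - \<alpha>"
    have e: "\<i> * \<alpha> - Complex x t = Complex (- x) (- v)" by (simp add: complex_eq_iff v_def)
    have "\<bar>t - \<alpha>\<bar> < 2 * pi" using t alpha by linarith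
    \<comment> \<open>For \<open>x = 0\<close> a vanishing denominator would force
      \<open>t = \<alpha>\<close>, which the hypothesis on \<open>Complex x t\<close>
      excludes.\<close>
    hence "x \<noteq> 0 \<or> cos (t - \<alpha>) \<noteq> 1"
      using z cos_eq_1_imp_zero[of "t - \<alpha>"] t alpha by (auto simp: complex_eq_iff)
    thus ?thesis unfolding k_def e v_def[symmetric] by (subst minus_inverse_exp_minus_one) auto
  qed
  also have "Im (k (- \<i> * \<alpha>)) = - (sin (t + \<alpha>) / (cosh x - cos (t + \<alpha>))) / 2"
  proof -
    define v where "v = t + \<alpha>"
    have e: "- \<i> * \<alpha> - Complex x t = Complex (- x) (- v)" by (simp add: complex_eq_iff v_def)
    have "\<bar>t + \<alpha>\<bar> < 2 * pi" using t alpha by linarith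
    hence "cos (t + \<alpha>) \<noteq> 1"
      using cos_eq_1_imp_zero[of "t + \<alpha>"] t alpha by auto
    thus ?thesis unfolding k_def e v_def[symmetric] by (subst minus_inverse_exp_minus_one) auto
  qed
  also have "2 * pi * (- w + (- p / 2 + - q / 2) / \<rho>) = - 2 * pi * w - pi / \<rho> * (p + q)" for w p q
    using rho(3) by (simp add: field_simps)
  finally show ?thesis .
qed

text \<open>With \<open>W = 1 - 1 / (1 + e)\<close>, shifting the argument by \<open>pi\<close>
  turns \<open>e\<close> into \<open>- e\<close>, so that \<open>minus_inverse_exp_minus_one\<close>
  applies.\<close>

lemma Im_W:
  assumes "x \<noteq> 0 \<or> cos (\<rho> * t) \<noteq> - 1"
  shows "Im (W (Complex x t)) = sin (\<rho> * t) / (2 * (cosh (\<rho> * x) + cos (\<rho> * t)))"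
proof -
  define e where "e = exp (complex_of_real \<rho> * Complex x t)"
  have e: "exp (Complex (\<rho> * x) (\<rho> * t + pi)) = - e"
    by (simp add: e_def complex_eq_iff Re_exp Im_exp)
  have ne: "\<rho> * x \<noteq> 0 \<or> cos (\<rho> * t + pi) \<noteq> 1" using assms rho(3) by auto
  have "0 < cosh (\<rho> * x) - cos (\<rho> * t + pi)" using ne by (simp only: cosh_minus_cos_pos_iff)
  define q where "q = - 1 / (exp (Complex (\<rho> * x) (\<rho> * t + pi)) - 1)"
  have 1: "1 / (1 + e) = q"
  proof -
    have "- e - 1 = - (1 + e)" by simp
    thus ?thesis unfolding q_def e by (simp only: minus_divide_divide)
  qed
  have "1 + e \<noteq> 0"
  proof
    assume "1 + e = 0"
    hence "exp (Complex (\<rho> * x) (\<rho> * t + pi)) = exp (Complex 0 0)" by (simp add: e add_eq_0_iff complex_eq_iff Re_exp Im_exp flip: zero_complex.ctr)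
    thus False using cmod_exp_diff(1)[of "\<rho> * x" 0 "\<rho> * t + pi" 0] ne by simp
  qed
  hence "W (Complex x t) = 1 - 1 / (1 + e)" by (simp add: W_def e_def field_simps)
  hence "Im (W (Complex x t)) = - (sin (\<rho> * t + pi) / (2 * (cosh (\<rho> * x) - cos (\<rho> * t + pi))))"
    unfolding 1 using minus_inverse_exp_minus_one[OF ne, folded q_def] by simp
  thus ?thesis by simp
qed

text \<open>Up to the factor \<open>2 * exp (\<rho> * x)\<close> this is the squared modulus of
  \<open>1 + exp (\<rho> * w)\<close> at \<open>w = Complex x t\<close>, whose only zero with
  \<open>0 \<le> t \<le> 2 * \<alpha>\<close> is \<open>\<i> * \<alpha>\<close>.\<close>

lemma cosh_plus_cos_pos:
  assumes "x \<noteq> 0 \<or> t \<noteq> \<alpha>" "0 \<le> t" "t \<le> 2 * \<alpha>"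
  shows "0 < cosh (\<rho> * x) + cos (\<rho> * t)"
proof -
  have "\<rho> * x \<noteq> 0 \<or> cos (\<rho> * t - pi) \<noteq> 1"
  proof (cases "x = 0")
    case True
    have "\<rho> * t - pi = \<rho> * (t - \<alpha>)" using rho(2) by (simp add: algebra_simps)
    moreover have "\<bar>\<rho> * (t - \<alpha>)\<bar> \<le> \<rho> * \<alpha>" unfolding abs_mult using rho(1) assms by (intro mult_mono) auto
    ultimately have "\<bar>\<rho> * t - pi\<bar> < 2 * pi" unfolding rho(2) using pi_gt_zero by linarith
    hence "cos (\<rho> * t - pi) \<noteq> 1"
      using cos_eq_1_imp_zero[of "\<rho> * t - pi"] True assms(1) rho(2,3) by (metis eq_iff_diff_eq_0 mult_left_cancel)
    thus ?thesis ..
  qed (use rho(3) in auto)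
  hence "0 < cosh (\<rho> * x) - cos (\<rho> * t - pi)" by (simp only: cosh_minus_cos_pos_iff)
  thus ?thesis by simp
qed

text \<open>Up to angle-free terms, \<open>E\<close> is the function \<open>u\<close> in the sector
  and \<open>A\<close> is the contribution of two atoms of mass \<open>1 / \<rho>\<close>. By
  \<open>ray_potential_diff\<close> and \<open>Im_W\<close>, \<open>2 * pi * (E - A)\<close> is an
  antiderivative, where \<open>min\<close> freezes \<open>E\<close> outside the sector.\<close>

lemma ray_potential_diff_integral:
  assumes \<theta>: "0 \<le> \<theta>" "\<theta> \<le> pi" and ne: "x \<noteq> 0 \<or> \<theta> \<noteq> \<alpha>"
  defines "E \<equiv> (\<lambda>t. ln (cosh (\<rho> * x) + cos (\<rho> * t)) / (2 * \<rho>))"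
    and "A \<equiv> (\<lambda>t. (log_kernel x (t - \<alpha>) + log_kernel x (t + \<alpha>)) / \<rho>)"
  shows "((\<lambda>t. ray_potential x (t - 2 * \<alpha>) - ray_potential x (t + 2 * \<alpha>)) has_integral
     2 * pi * ((E (min \<theta> (2 * \<alpha>)) - A \<theta>) - (E 0 - A 0))) {0..\<theta>}"
proof -
  \<comment> \<open>For \<open>x = 0\<close> both logarithms are singular at the atom \<open>t = \<alpha>\<close>, but their difference is not.\<close>
  define R where "R = (\<lambda>t. if x = 0 \<and> t = \<alpha> then ln (\<rho>\<^sup>2) else
     ln (cosh (\<rho> * x) + cos (\<rho> * min t (2 * \<alpha>))) - ln (cosh x - cos (t - \<alpha>)))"
  define B where "B = (\<lambda>t. 2 * pi * ((R t - ln (cosh x - cos (t + \<alpha>))) / (2 * \<rho>)))"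
  have B: "B t = 2 * pi * (E (min t (2 * \<alpha>)) - A t)" if "x \<noteq> 0 \<or> t \<noteq> \<alpha>" for t
    using that rho(3) by (auto simp: B_def R_def E_def A_def log_kernel_def field_simps)
  have pos1: "0 < cosh (\<rho> * x) + cos (\<rho> * min t (2 * \<alpha>))" if "x \<noteq> 0 \<or> t \<noteq> \<alpha>" "0 \<le> t" for t
    using that alpha by (intro cosh_plus_cos_pos) auto
  have abs2: "\<bar>t - \<alpha>\<bar> < 2 * pi" "\<bar>t + \<alpha>\<bar> < 2 * pi" if "0 \<le> t" "t \<le> pi" for t
    using that alpha by linarith+
  have pos2: "0 < cosh x - cos (t - \<alpha>)" if "x \<noteq> 0 \<or> t \<noteq> \<alpha>" "0 \<le> t" "t \<le> pi" for t
    unfolding cosh_minus_cos_pos_iff using that abs2[of t] cos_eq_1_imp_zero[of "t - \<alpha>"] by auto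
  have pos3: "0 < cosh x - cos (t + \<alpha>)" if "0 \<le> t" "t \<le> pi" for t
    unfolding cosh_minus_cos_pos_iff using that abs2[of t] alpha cos_eq_1_imp_zero[of "t + \<alpha>"] by auto
  have contR: "isCont R t" if t: "t \<in> {0..\<theta>}" for t
  proof (cases "x = 0 \<and> t = \<alpha>")
    case False
    have c: "isCont (\<lambda>t. ln (cosh (\<rho> * x) + cos (\<rho> * min t (2 * \<alpha>))) - ln (cosh x - cos (t - \<alpha>))) t"
      using pos1[of t] pos2[of t] False t \<theta> by (intro continuous_intros) auto
    have ev: "eventually (\<lambda>s. R s = ln (cosh (\<rho> * x) + cos (\<rho> * min s (2 * \<alpha>))) - ln (cosh x - cos (s - \<alpha>)))
        (nhds t)"
    proof (cases "x = 0")
      case True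
      hence "t \<noteq> \<alpha>" using False by simp
      from t1_space_nhds[OF this] show ?thesis by eventually_elim (simp add: R_def)
    qed (simp add: R_def)
    show ?thesis using c isCont_cong[OF ev] by simp
  next
    case True
    have "((\<lambda>s. (1 - cos (\<rho> * (s - \<alpha>))) / (1 - cos (s - \<alpha>))) \<longlongrightarrow> \<rho>\<^sup>2) (at \<alpha>)"
      by (rule LIM_offset_zero_cancel) (use one_minus_cos_quotient_tendsto[of \<rho>] rho(1) in simp)
    hence "((\<lambda>s. ln ((1 - cos (\<rho> * (s - \<alpha>))) / (1 - cos (s - \<alpha>)))) \<longlongrightarrow> ln (\<rho>\<^sup>2)) (at \<alpha>)"
      using rho(3) by (intro tendsto_ln) auto
    moreover have "eventually (\<lambda>s. ln ((1 - cos (\<rho> * (s - \<alpha>))) / (1 - cos (s - \<alpha>))) = R s) (at \<alpha>)"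
    proof -
      have "eventually (\<lambda>s. s \<in> {0<..<2 * \<alpha>}) (at \<alpha>)"
        using alpha by (intro eventually_at_in_open') auto
      moreover have "eventually (\<lambda>s. s \<noteq> \<alpha>) (at \<alpha>)" by (simp add: eventually_at_filter)
      ultimately show ?thesis
      proof eventually_elim
        case (elim s)
        have "cos (\<rho> * (s - \<alpha>)) = - cos (\<rho> * s)" using rho(2) by (simp add: right_diff_distrib)
        thus ?case using elim True pos1[of s] pos2[of s] alpha by (simp add: R_def ln_div)
      qed
    qed
    ultimately have "(R \<longlongrightarrow> R \<alpha>) (at \<alpha>)"
      using Lim_transform_eventually True by (simp add: R_def)
    thus "isCont R t" using True by (simp add: isCont_def)
  qed
  have "isCont B t" if "t \<in> {0..\<theta>}" for t
    unfolding B_def using contR[OF that] pos3[of t] that \<theta> rho(3) by (intro continuous_intros) auto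
  hence contB: "continuous_on {0..\<theta>} B" by (simp add: continuous_at_imp_continuous_on)
  have "((\<lambda>t. ray_potential x (t - 2 * \<alpha>) - ray_potential x (t + 2 * \<alpha>)) has_integral B \<theta> - B 0) {0..\<theta>}"
  proof (rule fundamental_theorem_of_calculus_interior_strong[where S="{\<alpha>, 2 * \<alpha>}", OF _ \<theta>(1) _ contB])
    fix t assume "t \<in> {0<..<\<theta>} - {\<alpha>, 2 * \<alpha>}"
    hence t: "0 < t" "t < pi" "t \<noteq> \<alpha>" "t \<noteq> 2 * \<alpha>" using \<theta> by auto
    have p: "cosh x - cos (t - \<alpha>) > 0" "cosh x - cos (t + \<alpha>) > 0" using pos2[of t] pos3[of t] t by auto
    have A': "(A has_real_derivative
        (sin (t - \<alpha>) / (cosh x - cos (t - \<alpha>)) + sin (t + \<alpha>) / (cosh x - cos (t + \<alpha>))) / (2 * \<rho>)) (at t)"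
    proof -
      have d: "((\<lambda>t. log_kernel x (t + b)) has_real_derivative (sin (t + b) / (cosh x - cos (t + b))) / 2) (at t)"
        if "cosh x - cos (t + b) > 0" for b
        unfolding log_kernel_def by (rule DERIV_cdivide) (use that in \<open>auto intro!: derivative_eq_intros\<close>)
      have "(A has_real_derivative ((sin (t + (- \<alpha>)) / (cosh x - cos (t + (- \<alpha>)))) / 2
           + (sin (t + \<alpha>) / (cosh x - cos (t + \<alpha>))) / 2) / \<rho>) (at t)"
        unfolding A_def using d[of "- \<alpha>"] d[of \<alpha>] p by (intro DERIV_cdivide DERIV_add) auto
      moreover have "(u / 2 + v / 2) / \<rho> = (u + v) / (2 * \<rho>)" for u v
        using rho(3) by (simp add: field_simps)
      ultimately show ?thesis by (simp only: diff_conv_add_uminus)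
    qed
    have E': "((\<lambda>t. E (min t (2 * \<alpha>))) has_real_derivative
        - (if t < 2 * \<alpha> then Im (W (Complex x t)) else 0)) (at t)"
    proof (cases "t < 2 * \<alpha>")
      case True
      have "0 < cosh (\<rho> * x) + cos (\<rho> * t)" using t True by (intro cosh_plus_cos_pos) auto
      hence "((\<lambda>t. ln (cosh (\<rho> * x) + cos (\<rho> * t))) has_real_derivative
          - (sin (\<rho> * t) * \<rho>) / (cosh (\<rho> * x) + cos (\<rho> * t))) (at t)"
        by (auto intro!: derivative_eq_intros)
      hence "(E has_real_derivative - (sin (\<rho> * t) * \<rho>) / (cosh (\<rho> * x) + cos (\<rho> * t)) / (2 * \<rho>)) (at t)"
        unfolding E_def by (rule DERIV_cdivide)
      moreover have "x \<noteq> 0 \<or> cos (\<rho> * t) \<noteq> - 1" using cosh_plus_cos_pos[of x t] t True by auto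
      ultimately have "(E has_real_derivative - Im (W (Complex x t))) (at t)"
        using rho(3) by (simp add: Im_W mult.commute)
      moreover have "eventually (\<lambda>s. E (min s (2 * \<alpha>)) = E s) (nhds t)"
        using eventually_nhds_in_open[of "{..<2 * \<alpha>}" t] True by (auto elim!: eventually_mono)
      ultimately show ?thesis using True by (simp add: DERIV_cong_ev)
    next
      case False
      have "eventually (\<lambda>s. E (min s (2 * \<alpha>)) = E (2 * \<alpha>)) (nhds t)"
        using eventually_nhds_in_open[of "{2 * \<alpha><..}" t] False t by (auto elim!: eventually_mono)
      thus ?thesis using False by (simp add: DERIV_cong_ev)
    qed
    have "((\<lambda>t. 2 * pi * (E (min t (2 * \<alpha>)) - A t)) has_real_derivative
        2 * pi * (- (if t < 2 * \<alpha> then Im (W (Complex x t)) else 0)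
         - (sin (t - \<alpha>) / (cosh x - cos (t - \<alpha>)) + sin (t + \<alpha>) / (cosh x - cos (t + \<alpha>))) / (2 * \<rho>))) (at t)"
      by (intro DERIV_cmult DERIV_diff E' A')
    also have "2 * pi * (- (if t < 2 * \<alpha> then Im (W (Complex x t)) else 0)
         - (sin (t - \<alpha>) / (cosh x - cos (t - \<alpha>)) + sin (t + \<alpha>) / (cosh x - cos (t + \<alpha>))) / (2 * \<rho>))
       = ray_potential x (t - 2 * \<alpha>) - ray_potential x (t + 2 * \<alpha>)"
      using t rho(3) by (subst ray_potential_diff) (auto simp: complex_eq_iff field_simps)
    finally have "((\<lambda>t. 2 * pi * (E (min t (2 * \<alpha>)) - A t)) has_real_derivative
       ray_potential x (t - 2 * \<alpha>) - ray_potential x (t + 2 * \<alpha>)) (at t)" .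
    moreover have "eventually (\<lambda>s. 2 * pi * (E (min s (2 * \<alpha>)) - A s) = B s) (nhds t)"
      using t1_space_nhds[OF t(3)] by eventually_elim (simp add: B)
    ultimately have "(B has_real_derivative ray_potential x (t - 2 * \<alpha>) - ray_potential x (t + 2 * \<alpha>)) (at t)"
      by (simp add: DERIV_cong_ev)
    thus "(B has_vector_derivative ray_potential x (t - 2 * \<alpha>) - ray_potential x (t + 2 * \<alpha>)) (at t)"
      by (simp add: has_real_derivative_iff_has_vector_derivative)
  qed simp
  moreover have "B \<theta> - B 0 = 2 * pi * ((E (min \<theta> (2 * \<alpha>)) - A \<theta>) - (E 0 - A 0))"
    using B[of \<theta>] B[of 0] ne alpha by (simp add: right_diff_distrib)
  ultimately show ?thesis by simp
qed

subsection \<open>The extremal measure\<close>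

text \<open>The open interval is invariant under reflection and lies inside the principal branch of
  the argument.\<close>

definition angle_measure :: "real measure" where
  "angle_measure = density lborel (\<lambda>\<phi>. ennreal (indicator {-pi<..<pi} \<phi> / (2 * pi)))"

text \<open>The variable is the logarithm of the modulus, not the modulus.\<close>

definition radial_measure :: "real measure" where
  "radial_measure = density lborel (\<lambda>y. ennreal (logistic_density y))"

text \<open>
  The atoms arise by collapsing the sectors \<open>0 < \<phi> < 2\<alpha>\<close> and \<open>-2\<alpha> < \<phi> < 0\<close>, of angular measure
  \<open>\<alpha> / pi\<close> each, to the points \<open>e^(\<plusminus>i\<alpha>)\<close>.  The value at \<open>\<phi> = 0\<close> is real, so that
  \<open>\<phi> \<mapsto> -\<phi>\<close> corresponds exactly to complex conjugation.
\<close>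

definition charge_point :: "real \<times> real \<Rightarrow> complex" where
  "charge_point = (\<lambda>(\<phi>, y). if \<bar>\<phi>\<bar> < 2 * \<alpha> then exp (Complex 0 (\<alpha> * sgn \<phi>)) else exp (Complex y \<phi>))"

definition sector_measure :: "complex measure" where
  "sector_measure = distr (angle_measure \<Otimes>\<^sub>M radial_measure) borel charge_point"

lemma sets_angle_measure [measurable_cong, simp]: "sets angle_measure = sets borel"
  and space_angle_measure [simp]: "space angle_measure = UNIV"
  and sets_radial_measure [measurable_cong, simp]: "sets radial_measure = sets borel"
  and space_radial_measure [simp]: "space radial_measure = UNIV"
  by (simp_all add: angle_measure_def radial_measure_def)

lemma emeasure_angle_measure:
  assumes [measurable]: "A \<in> sets borel"
  shows "emeasure angle_measure A = emeasure lborel (A \<inter> {-pi<..<pi}) / ennreal (2 * pi)"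
proof -
  have "emeasure angle_measure A = (\<integral>\<^sup>+\<phi>. (1 / ennreal (2 * pi)) * indicator (A \<inter> {-pi<..<pi}) \<phi> \<partial>lborel)"
    unfolding angle_measure_def
    using divide_ennreal[of 1 "2 * pi"]
    by (subst emeasure_density) (auto intro!: nn_integral_cong simp: indicator_def)
  also have "\<dots> = emeasure lborel (A \<inter> {-pi<..<pi}) / ennreal (2 * pi)"
    by (subst nn_integral_cmult_indicator) (auto simp: ennreal_divide_times)
  finally show ?thesis .
qed

lemma prob_space_angle_measure: "prob_space angle_measure"
  by (rule prob_spaceI) (simp add: emeasure_angle_measure divide_ennreal)

text \<open>The function \<open>logistic\<close> is an antiderivative of the density and increases
  from 0 to 1.\<close>

lemma prob_space_radial_measure: "prob_space radial_measure"
proof (rule prob_spaceI)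
  have "eventually (\<lambda>R. (logistic_density has_integral logistic R - logistic (- R)) {-R..R}) at_top"
    using eventually_ge_at_top[of 0]
  proof eventually_elim
    case (elim R)
    thus ?case
      by (intro fundamental_theorem_of_calculus)
        (auto simp: has_real_derivative_iff_has_vector_derivative[symmetric] intro: has_derivative_logistic)
  qed
  moreover have "((\<lambda>R. logistic R - logistic (- R)) \<longlongrightarrow> 1) at_top"
    using rho(1) unfolding logistic_def by real_asymp
  ultimately have "integral\<^sup>L lborel logistic_density = 1"
    by (rule tendsto_integral_symmetric_interval[OF integrable_logistic_density])
  moreover have "(\<integral>\<^sup>+y. ennreal (logistic_density y) \<partial>lborel) = ennreal (integral\<^sup>L lborel logistic_density)"
    using integrable_logistic_density logistic_density_pos by (intro nn_integral_eq_integral) (auto simp: less_imp_le)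
  ultimately show "emeasure radial_measure (space radial_measure) = 1"
    unfolding radial_measure_def by (simp add: emeasure_density)
qed

sublocale charge: pair_prob_space angle_measure radial_measure
  using prob_space_angle_measure prob_space_radial_measure
  by (simp add: pair_prob_space_def pair_sigma_finite_def prob_space_imp_sigma_finite)

lemma borel_measurable_charge_point [measurable]:
  "charge_point \<in> borel_measurable (angle_measure \<Otimes>\<^sub>M radial_measure)"
proof -
  have e: "exp (Complex a b) = complex_of_real (exp a) * cis b" for a b
    by (simp add: exp_eq_polar)
  have [measurable]: "cis \<in> borel_measurable borel" "(sgn :: real \<Rightarrow> real) \<in> borel_measurable borel"
    by (auto intro!: borel_measurable_continuous_onI continuous_intros simp: sgn_real_def[abs_def])
  show ?thesis unfolding charge_point_def e by measurable
qed

lemma prob_space_sector_measure: "prob_space sector_measure"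
  unfolding sector_measure_def by (rule charge.prob_space_distr) measurable

lemma sets_sector_measure: "sets sector_measure = sets borel"
  by (simp add: sector_measure_def)

lemma distr_angle_measure_uminus: "distr angle_measure angle_measure uminus = angle_measure"
proof (rule measure_eqI)
  fix A assume "A \<in> sets (distr angle_measure angle_measure uminus)"
  hence [measurable]: "A \<in> sets borel" by simp
  have "emeasure (distr angle_measure angle_measure uminus) A = emeasure angle_measure (uminus -` A)"
    by (subst emeasure_distr) auto
  also have "\<dots> = emeasure lborel (uminus -` A \<inter> {-pi<..<pi}) / ennreal (2 * pi)"
    by (rule emeasure_angle_measure) (use measurable_sets_borel[of "uminus :: real \<Rightarrow> real" borel A] in auto)
  also have "uminus -` A \<inter> {-pi<..<pi} = uminus -` (A \<inter> {-pi<..<pi})" by auto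
  also have "emeasure lborel \<dots> = emeasure (distr lborel borel uminus) (A \<inter> {-pi<..<pi})"
    by (subst emeasure_distr) auto
  also have "\<dots> = emeasure lborel (A \<inter> {-pi<..<pi})" by (simp add: lborel_distr_uminus)
  also have "\<dots> / ennreal (2 * pi) = emeasure angle_measure A" by (simp add: emeasure_angle_measure)
  finally show "emeasure (distr angle_measure angle_measure uminus) A = emeasure angle_measure A" .
qed simp

text \<open>As \<open>sgn\<close> is odd, \<open>charge_point\<close> carries the reflection of
  \<open>\<phi>\<close> to conjugation, and the product measure is invariant under this
  reflection.\<close>

lemma distr_sector_measure_cnj: "distr sector_measure borel cnj = sector_measure"
proof -
  have [measurable]: "cnj \<in> borel_measurable borel"
    by (intro borel_measurable_continuous_onI continuous_intros)
  let ?P = "angle_measure \<Otimes>\<^sub>M radial_measure" and ?n = "\<lambda>(\<phi>, y). (- \<phi> :: real, y :: real)"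
  have c: "cnj (charge_point p) = charge_point (?n p)" for p
  proof -
    have "cnj (exp (Complex a b)) = exp (Complex a (- b))" for a b
      by (simp add: complex_eq_iff Re_exp Im_exp)
    thus ?thesis by (cases p) (simp add: charge_point_def sgn_minus)
  qed
  have "distr angle_measure angle_measure uminus \<Otimes>\<^sub>M distr radial_measure radial_measure (\<lambda>y. y)
     = distr ?P ?P ?n"
    by (rule pair_measure_distr) (auto simp: distr_id[unfolded id_def] charge.M2.sigma_finite_measure_axioms)
  hence P: "distr ?P ?P ?n = ?P" by (simp add: distr_angle_measure_uminus distr_id[unfolded id_def])
  have "distr sector_measure borel cnj = distr ?P borel (\<lambda>p. charge_point (?n p))"
    unfolding sector_measure_def by (subst distr_distr) (auto simp: comp_def c)
  also have "\<dots> = distr (distr ?P ?P ?n) borel charge_point"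
    by (subst distr_distr) (auto simp: comp_def)
  also have "\<dots> = sector_measure" by (simp add: P sector_measure_def)
  finally show ?thesis .
qed

lemma symmetric_sector_measure: "symmetric_wrt_real_line sector_measure"
  unfolding symmetric_wrt_real_line_def
proof
  fix E :: "complex set" assume E: "E \<in> sets borel"
  have [measurable]: "cnj \<in> borel_measurable borel"
    by (intro borel_measurable_continuous_onI continuous_intros)
  have img: "cnj -` E = cnj ` E"
  proof -
    have "w \<in> cnj ` E" if "cnj w \<in> E" for w using imageI[OF that, of cnj] by simp
    thus ?thesis by auto
  qed
  have "emeasure sector_measure E = emeasure (distr sector_measure borel cnj) E"
    by (simp add: distr_sector_measure_cnj)
  also have "\<dots> = emeasure sector_measure (cnj ` E)"
    using E by (subst emeasure_distr) (auto simp: sector_measure_def img)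
  finally show "emeasure sector_measure E = emeasure sector_measure (cnj ` E)" .
qed

text \<open>Angles with \<open>\<bar>\<phi>\<bar> < 2 * \<alpha>\<close> collapse to 0 or
  \<open>\<plusminus> \<alpha>\<close>, and all others are kept. So the sector of half-angle
  \<open>\<alpha>\<close> receives the mass of an angular interval twice as wide.\<close>

lemma Arg_charge_point:
  assumes "\<phi> \<in> {-pi<..<pi}"
  shows "\<bar>Arg (charge_point (\<phi>, y))\<bar> \<le> \<alpha> \<longleftrightarrow> \<bar>\<phi>\<bar> < 2 * \<alpha>"
proof (cases "\<bar>\<phi>\<bar> < 2 * \<alpha>")
  case True
  have "\<alpha> * sgn \<phi> \<in> {-pi<..pi}" using alpha by (auto simp: sgn_if)
  hence "Arg (exp (Complex 0 (\<alpha> * sgn \<phi>))) = \<alpha> * sgn \<phi>" by (subst Arg_exp) auto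
  thus ?thesis using True alpha by (simp add: charge_point_def abs_mult abs_sgn_eq)
next
  case False
  have "Arg (exp (Complex y \<phi>)) = \<phi>" using assms by (subst Arg_exp) auto
  thus ?thesis using False alpha by (simp add: charge_point_def)
qed

text \<open>The preimage is, up to a null set, an angular interval of length
  \<open>4 * \<alpha>\<close> out of \<open>2 * pi\<close>.\<close>

lemma measure_sector_measure:
  "measure sector_measure {z. z \<noteq> 0 \<and> \<bar>Arg z\<bar> \<le> \<alpha>} = 2 * \<alpha> / pi"
proof -
  let ?P = "angle_measure \<Otimes>\<^sub>M radial_measure"
  let ?S = "{z. z \<noteq> 0 \<and> \<bar>Arg z\<bar> \<le> \<alpha>}"
  have "?S = {z. z \<noteq> 0 \<and> \<bar>Im (Ln z)\<bar> \<le> \<alpha>}" by (auto simp: Arg_eq_Im_Ln)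
  also have "\<dots> \<in> sets borel"
    by measurable
  finally have S [measurable]: "?S \<in> sets borel" .
  have AE: "AE p in ?P. fst p \<in> {-pi<..<pi}"
  proof (rule charge.AE_pair_measure)
    show "AE \<phi> in angle_measure. AE y in radial_measure. fst (\<phi>, y) \<in> {-pi<..<pi}"
      unfolding angle_measure_def by (subst AE_density) (auto simp: indicator_def)
  qed measurable
  have "emeasure sector_measure ?S = emeasure ?P (charge_point -` ?S \<inter> space ?P)"
    unfolding sector_measure_def by (rule emeasure_distr) measurable
  also have "\<dots> = emeasure ?P ({-2*\<alpha><..<2*\<alpha>} \<times> UNIV)"
  proof (rule emeasure_eq_AE)
    show "AE p in ?P. p \<in> charge_point -` ?S \<inter> space ?P \<longleftrightarrow> p \<in> {-2*\<alpha><..<2*\<alpha>} \<times> UNIV"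
      using AE
    proof eventually_elim
      case (elim p)
      have "charge_point p \<noteq> 0" by (simp add: charge_point_def split: prod.split)
      thus ?case using Arg_charge_point[of "fst p" "snd p"] elim by (auto simp: space_pair_measure mem_Times_iff)
    qed
    show "charge_point -` ?S \<inter> space ?P \<in> sets ?P" by measurable
  qed auto
  also have "\<dots> = emeasure angle_measure {-2*\<alpha><..<2*\<alpha>} * emeasure radial_measure UNIV"
    by (rule charge.M2.emeasure_pair_measure_Times) auto
  also have "emeasure radial_measure UNIV = 1" using charge.M2.emeasure_space_1 by simp
  also have "emeasure angle_measure {-2*\<alpha><..<2*\<alpha>} = ennreal (2 * \<alpha> / pi)"
  proof -
    have "{-2*\<alpha><..<2*\<alpha>} \<inter> {-pi<..<pi} = {-2*\<alpha><..<2*\<alpha>}" using alpha by auto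
    thus ?thesis using alpha by (simp add: emeasure_angle_measure divide_ennreal)
  qed
  finally show ?thesis using alpha by (simp add: measure_def)
qed

text \<open>A whole half-sector, of angular measure \<open>\<alpha> / pi\<close>, is mapped to this
  point.\<close>

lemma emeasure_atom:
  assumes s: "s = 1 \<or> s = - 1"
  shows "emeasure sector_measure {exp (Complex 0 (\<alpha> * s))} \<noteq> 0"
proof -
  let ?P = "angle_measure \<Otimes>\<^sub>M radial_measure"
  define I where "I = (if s = 1 then {0<..<2 * \<alpha>} else {- 2 * \<alpha><..<0})"
  have I: "I \<inter> {-pi<..<pi} = I" "emeasure lborel I = ennreal (2 * \<alpha>)" "I \<in> sets borel"
    using alpha by (auto simp: I_def)
  have "0 < ennreal (2 * \<alpha>) / ennreal (2 * pi)" using alpha by (simp add: divide_ennreal)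
  also have "\<dots> = emeasure angle_measure I * emeasure radial_measure UNIV"
    using I charge.M2.emeasure_space_1 by (simp add: emeasure_angle_measure)
  also have "\<dots> = emeasure ?P (I \<times> UNIV)"
    using I by (intro charge.M2.emeasure_pair_measure_Times[symmetric]) auto
  also have "\<dots> \<le> emeasure ?P (charge_point -` {exp (Complex 0 (\<alpha> * s))} \<inter> space ?P)"
  proof (rule emeasure_mono)
    show "I \<times> UNIV \<subseteq> charge_point -` {exp (Complex 0 (\<alpha> * s))} \<inter> space ?P"
      using s by (auto simp: I_def charge_point_def space_pair_measure split: if_splits)
    show "charge_point -` {exp (Complex 0 (\<alpha> * s))} \<inter> space ?P \<in> sets ?P" by measurable
  qed
  also have "\<dots> = emeasure sector_measure {exp (Complex 0 (\<alpha> * s))}"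
    unfolding sector_measure_def by (rule emeasure_distr[symmetric]) measurable
  finally show ?thesis by simp
qed

section \<open>The potential of the extremal measure\<close>

lemma not_atom:
  assumes "0 \<le> \<theta>" "\<theta> \<le> pi" "x \<noteq> 0 \<or> \<theta> \<noteq> \<alpha>" "s = 1 \<or> s = - 1"
  shows "x \<noteq> 0 \<or> cos (\<theta> - \<alpha> * s) \<noteq> 1"
proof -
  have "\<bar>\<theta> - \<alpha> * s\<bar> < 2 * pi" using assms alpha by (auto; linarith)
  thus ?thesis using assms alpha cos_eq_1_imp_zero[of "\<theta> - \<alpha> * s"] by auto
qed

text \<open>At \<open>\<phi> = 0\<close> the charge sits at 1 instead of at an atom, and at
  \<open>y = x\<close> the kernel may be singular.\<close>

lemma AE_charge:
  "AE p in angle_measure \<Otimes>\<^sub>M radial_measure. fst p \<noteq> 0 \<and> snd p \<noteq> x"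
proof (rule charge.AE_pair_measure)
  have "AE y in lborel. ennreal (logistic_density y) > 0 \<longrightarrow> y \<noteq> x"
    using AE_lborel_singleton[of x] by eventually_elim auto
  hence "AE y in radial_measure. y \<noteq> x" unfolding radial_measure_def by (subst AE_density) auto
  moreover have "AE \<phi> in lborel. ennreal (indicator {-pi<..<pi} \<phi> / (2 * pi)) > 0 \<longrightarrow> \<phi> \<noteq> 0"
    using AE_lborel_singleton[of "0::real"] by eventually_elim auto
  hence "AE \<phi> in angle_measure. \<phi> \<noteq> 0" unfolding angle_measure_def by (subst AE_density) auto
  ultimately show "AE \<phi> in angle_measure. AE y in radial_measure. fst (\<phi>, y) \<noteq> 0 \<and> snd (\<phi>, y) \<noteq> x"
    by auto
qed measurable

text \<open>Both cases are instances of \<open>cmod_exp_diff\<close>; an atom lies on the unit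
  circle, so its radial coordinate is 0.\<close>

lemma ln_cmod_charge:
  assumes "0 \<le> \<theta>" "\<theta> \<le> pi" "x \<noteq> 0 \<or> \<theta> \<noteq> \<alpha>" "\<phi> \<noteq> 0" "y \<noteq> x"
  shows "charge_point (\<phi>, y) \<noteq> exp (Complex x \<theta>)"
    and "ln (cmod (exp (Complex x \<theta>) - charge_point (\<phi>, y))) =
      (if \<bar>\<phi>\<bar> < 2 * \<alpha> then (ln 2 + x) / 2 + log_kernel x (\<theta> - \<alpha> * sgn \<phi>)
       else (ln 2 + x + y) / 2 + log_kernel (y - x) (\<theta> - \<phi>))"
proof -
  have "x \<noteq> 0 \<or> cos (\<theta> - \<alpha> * sgn \<phi>) \<noteq> 1" using assms by (intro not_atom) (auto simp: sgn_if)
  note 1 = cmod_exp_diff[OF this] and 2 = cmod_exp_diff[of x y \<theta> \<phi>]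
  show "charge_point (\<phi>, y) \<noteq> exp (Complex x \<theta>)"
    using 1(1) 2(1) assms(5) by (auto simp: charge_point_def)
  show "ln (cmod (exp (Complex x \<theta>) - charge_point (\<phi>, y))) =
      (if \<bar>\<phi>\<bar> < 2 * \<alpha> then (ln 2 + x) / 2 + log_kernel x (\<theta> - \<alpha> * sgn \<phi>)
       else (ln 2 + x + y) / 2 + log_kernel (y - x) (\<theta> - \<phi>))"
    using 1(2) 2(2) assms(5) by (auto simp: charge_point_def log_kernel_minus)
qed

lemma borel_measurable_potential_kernel [measurable]: "potential_kernel z \<in> borel_measurable borel"
  unfolding potential_kernel_def by measurable

lemma integrable_radial_iff:
  assumes "f \<in> borel_measurable borel"
  shows "integrable radial_measure f \<longleftrightarrow> integrable lborel (\<lambda>y. logistic_density y * f y :: real)"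
  unfolding radial_measure_def using assms logistic_density_pos
  by (subst integrable_density) (auto simp: less_imp_le)

lemma integral_radial:
  assumes "f \<in> borel_measurable borel"
  shows "(\<integral>y. f y \<partial>radial_measure) = (\<integral>y. logistic_density y * f y \<partial>lborel)"
  unfolding radial_measure_def using assms logistic_density_pos
  by (subst integral_density) (auto simp: less_imp_le)

lemma borel_measurable_log_kernel_bound [measurable]: "log_kernel_bound \<in> borel_measurable borel"
  unfolding log_kernel_bound_def[abs_def] by measurable

text \<open>The majorant depends on the radial variable only: \<open>C\<close> covers both atoms and
  \<open>log_kernel_bound\<close> the rest, while the normalising term is 0 or
  \<open>y\<close>.\<close>

lemma integrable_potential_kernel_charge:
  assumes \<theta>: "0 \<le> \<theta>" "\<theta> \<le> pi" "x \<noteq> 0 \<or> \<theta> \<noteq> \<alpha>"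
  shows "integrable (angle_measure \<Otimes>\<^sub>M radial_measure) (\<lambda>p. potential_kernel (exp (Complex x \<theta>)) (charge_point p))"
proof -
  let ?P = "angle_measure \<Otimes>\<^sub>M radial_measure"
  define C where "C = \<bar>log_kernel x (\<theta> - \<alpha>)\<bar> + \<bar>log_kernel x (\<theta> + \<alpha>)\<bar> + 2 + \<bar>x\<bar>"
  define b where "b = (\<lambda>y. C + 2 * \<bar>y\<bar> + log_kernel_bound (y - x))"
  have [measurable]: "b \<in> borel_measurable borel" unfolding b_def by measurable
  have "integrable lborel (\<lambda>y. logistic_density y * C + 2 * (logistic_density y * \<bar>y\<bar>)
      + logistic_density y * log_kernel_bound (y - x))"
    by (intro Bochner_Integration.integrable_add integrable_mult_left integrable_mult_right
        integrable_logistic_density integrable_logistic_density_abs integrable_density_log_kernel_bound)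
  hence "integrable radial_measure b"
    by (subst integrable_radial_iff) (auto simp: b_def algebra_simps)
  hence "integrable ?P (\<lambda>p. b (snd p))" by (rule charge.integrable_comp_snd)
  thus ?thesis
  proof (rule Bochner_Integration.integrable_bound)
    show "AE p in ?P. norm (potential_kernel (exp (Complex x \<theta>)) (charge_point p)) \<le> norm (b (snd p))"
      using AE_charge[of x]
    proof eventually_elim
      case (elim p)
      obtain \<phi> y where p: "p = (\<phi>, y)" by (cases p)
      with elim have ne: "\<phi> \<noteq> 0" "y \<noteq> x" by auto
      have lb: "0 \<le> log_kernel_bound (y - x)" by (simp add: log_kernel_bound_def)
      have ln2: "0 < ln (2::real)" "ln 2 \<le> (1::real)" using ln_le_minus_one[of 2] by auto
      have "\<bar>potential_kernel (exp (Complex x \<theta>)) (charge_point (\<phi>, y))\<bar> \<le> b y"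
      proof (cases "\<bar>\<phi>\<bar> < 2 * \<alpha>")
        case True
        have "\<bar>log_kernel x (\<theta> - \<alpha> * sgn \<phi>)\<bar> + 2 + \<bar>x\<bar> \<le> C"
          using ne by (auto simp: sgn_if C_def)
        hence "\<bar>ln 2 / 2 + x / 2 + log_kernel x (\<theta> - \<alpha> * sgn \<phi>)\<bar> \<le> C + 2 * \<bar>y\<bar> + log_kernel_bound (y - x)"
          using lb ln2 by linarith
        moreover have "\<not> 1 < cmod (charge_point (\<phi>, y))" using True by (simp add: charge_point_def)
        ultimately show ?thesis
          unfolding potential_kernel_def ln_cmod_charge(2)[OF \<theta> ne] b_def
          using True by (simp add: add_divide_distrib)
      next
        case False
        have C: "2 + \<bar>x\<bar> \<le> C" by (simp add: C_def)
        have L: "\<bar>log_kernel (y - x) (\<theta> - \<phi>)\<bar> \<le> log_kernel_bound (y - x)"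
          using ne by (intro abs_log_kernel_le) simp
        have "\<bar>ln 2 / 2 + x / 2 + y / 2 + log_kernel (y - x) (\<theta> - \<phi>) - e\<bar> \<le> C + 2 * \<bar>y\<bar> + log_kernel_bound (y - x)"
          if "e = y \<or> e = 0" for e
          using C L ln2 that by (elim disjE) linarith+
        moreover have "cmod (charge_point (\<phi>, y)) = exp y" using False by (simp add: charge_point_def)
        ultimately show ?thesis
          unfolding potential_kernel_def ln_cmod_charge(2)[OF \<theta> ne] b_def
          using False by (simp add: add_divide_distrib)
      qed
      thus ?case by (simp add: p)
    qed
  qed measurable
qed

lemma potential_sector_measure:
  assumes \<theta>: "0 \<le> \<theta>" "\<theta> \<le> pi" "x \<noteq> 0 \<or> \<theta> \<noteq> \<alpha>"
  shows "potential sector_measure (exp (Complex x \<theta>)) =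
     ereal (\<integral>p. potential_kernel (exp (Complex x \<theta>)) (charge_point p) \<partial>(angle_measure \<Otimes>\<^sub>M radial_measure))"
proof -
  have "AE p in angle_measure \<Otimes>\<^sub>M radial_measure. charge_point p \<noteq> exp (Complex x \<theta>)"
    using AE_charge[of x] by eventually_elim (use ln_cmod_charge(1)[OF \<theta>] in \<open>auto simp: split_paired_all\<close>)
  hence "AE \<zeta> in sector_measure. \<zeta> \<noteq> exp (Complex x \<theta>)"
    unfolding sector_measure_def by (subst AE_distr_iff) auto
  moreover have "integrable sector_measure (potential_kernel (exp (Complex x \<theta>)))"
    unfolding sector_measure_def using integrable_potential_kernel_charge[OF \<theta>]
    by (subst integrable_distr_eq) auto
  ultimately have "potential sector_measure (exp (Complex x \<theta>)) = ereal (\<integral>\<zeta>. potential_kernel (exp (Complex x \<theta>)) \<zeta> \<partial>sector_measure)"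
    by (intro potential_eq_integral sets_sector_measure)
  thus ?thesis unfolding sector_measure_def by (simp add: integral_distr)
qed

text \<open>A bridge from the Bochner to the gauge integral, for which the null set where
  \<open>f\<close> and \<open>G\<close> differ and the two endpoints are negligible.\<close>

lemma integral_angle:
  assumes int: "integrable angle_measure f" and AE: "AE \<phi> in angle_measure. f \<phi> = G \<phi>"
    and G: "(G has_integral S) {-pi..pi}"
  shows "(\<integral>\<phi>. f \<phi> \<partial>angle_measure) = S / (2 * pi)"
proof -
  have [measurable]: "f \<in> borel_measurable borel"
    using borel_measurable_integrable[OF int] by (simp add: measurable_cong_sets[OF sets_angle_measure refl])
  let ?w = "\<lambda>\<phi>. indicator {-pi<..<pi} \<phi> / (2 * pi)"
  have e: "(\<integral>\<phi>. f \<phi> \<partial>angle_measure) = (\<integral>\<phi>. ?w \<phi> * f \<phi> \<partial>lborel)"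
    unfolding angle_measure_def by (subst integral_density) auto
  have "integrable lborel (\<lambda>\<phi>. ?w \<phi> * f \<phi>)"
    using int unfolding angle_measure_def by (subst (asm) integrable_density) auto
  from has_integral_integral_lborel[OF this]
  have 1: "((\<lambda>\<phi>. ?w \<phi> * f \<phi>) has_integral (\<integral>\<phi>. f \<phi> \<partial>angle_measure)) UNIV" unfolding e .
  have "AE \<phi> in lborel. ?w \<phi> > 0 \<longrightarrow> f \<phi> = G \<phi>"
    using AE unfolding angle_measure_def by (subst (asm) AE_density) auto
  hence "AE \<phi> in lborel. ?w \<phi> * f \<phi> = ?w \<phi> * G \<phi>"
    by eventually_elim (auto simp: indicator_def)
  hence "AE \<phi> in lebesgue. ?w \<phi> * f \<phi> = ?w \<phi> * G \<phi>" by (rule AE_completion)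
  then obtain N where N: "negligible N" "{\<phi>. ?w \<phi> * f \<phi> \<noteq> ?w \<phi> * G \<phi>} \<subseteq> N"
    by (auto simp: eventually_ae_filter negligible_iff_null_sets)
  have 2: "((\<lambda>\<phi>. ?w \<phi> * G \<phi>) has_integral S / (2 * pi)) UNIV"
  proof -
    have "((\<lambda>\<phi>. if \<phi> \<in> {-pi<..<pi} then G \<phi> / (2 * pi) else 0) has_integral S / (2 * pi)) UNIV"
      unfolding has_integral_restrict_UNIV has_integral_Icc_iff_Ioo[symmetric]
      using G by (rule has_integral_divide)
    also have "(\<lambda>\<phi>. if \<phi> \<in> {-pi<..<pi} then G \<phi> / (2 * pi) else 0) = (\<lambda>\<phi>. ?w \<phi> * G \<phi>)"
      by (auto simp: indicator_def)
    finally show ?thesis .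
  qed
  have "((\<lambda>\<phi>. ?w \<phi> * f \<phi>) has_integral S / (2 * pi)) UNIV"
    by (rule has_integral_spike[OF N(1) _ 2]) (use N(2) in auto)
  with 1 show ?thesis by (rule has_integral_unique)
qed

text \<open>Fubini splits the difference of the potentials into atoms and rays. The atoms contribute
  the increment of \<open>A\<close>, which cancels the \<open>A\<close> terms from the rays and
  leaves \<open>E (min \<theta> (2 * \<alpha>)) - E 0\<close>. This is at most 0 because the cosine
  in \<open>E 0\<close> is 1.\<close>

lemma potential_sector_measure_le:
  assumes \<theta>: "0 \<le> \<theta>" "\<theta> \<le> pi" "x \<noteq> 0 \<or> \<theta> \<noteq> \<alpha>"
  shows "potential sector_measure (exp (Complex x \<theta>)) \<le> potential sector_measure (exp (Complex x 0))"
proof -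
  let ?P = "angle_measure \<Otimes>\<^sub>M radial_measure"
  define g where "g = (\<lambda>p. potential_kernel (exp (Complex x \<theta>)) (charge_point p)
    - potential_kernel (exp (Complex x 0)) (charge_point p))"
  define c where "c = (\<lambda>s. log_kernel x (\<theta> - \<alpha> * s) - log_kernel x (0 - \<alpha> * s))"
  define r where "r = (\<lambda>\<phi>. ray_potential x (\<theta> - \<phi>) - ray_potential x (0 - \<phi>))"
  define G where "G = (\<lambda>\<phi>. if \<bar>\<phi>\<bar> < 2 * \<alpha> then c (sgn \<phi>) else r \<phi>)"
  define E where "E = (\<lambda>t. ln (cosh (\<rho> * x) + cos (\<rho> * t)) / (2 * \<rho>))"
  define A where "A = (\<lambda>t. (log_kernel x (t - \<alpha>) + log_kernel x (t + \<alpha>)) / \<rho>)"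
  have 0: "0 \<le> (0::real)" "0 \<le> pi" "x \<noteq> 0 \<or> 0 \<noteq> \<alpha>" using alpha by auto
  have int: "integrable ?P g" unfolding g_def
    by (intro Bochner_Integration.integrable_diff integrable_potential_kernel_charge \<theta> 0)
  \<comment> \<open>The normalising term and all terms free of the angle of observation
    cancel.\<close>
  have gval: "g (\<phi>, y) = (if \<bar>\<phi>\<bar> < 2 * \<alpha> then c (sgn \<phi>)
      else log_kernel (y - x) (\<theta> - \<phi>) - log_kernel (y - x) (0 - \<phi>))" if "\<phi> \<noteq> 0" "y \<noteq> x" for \<phi> y
    unfolding g_def potential_kernel_def ln_cmod_charge(2)[OF \<theta> that] ln_cmod_charge(2)[OF 0 that]
    by (simp add: c_def)
  have AEx: "AE y in radial_measure. y \<noteq> x"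
    using AE_lborel_singleton[of x] unfolding radial_measure_def by (subst AE_density) auto
  have inner: "(\<integral>y. g (\<phi>, y) \<partial>radial_measure) = G \<phi>" if "\<phi> \<noteq> 0" for \<phi>
  proof (cases "\<bar>\<phi>\<bar> < 2 * \<alpha>")
    case True
    have "(\<integral>y. g (\<phi>, y) \<partial>radial_measure) = (\<integral>y. c (sgn \<phi>) \<partial>radial_measure)"
    proof (rule integral_cong_AE)
      show "AE y in radial_measure. g (\<phi>, y) = c (sgn \<phi>)"
        using AEx by eventually_elim (use gval that True in auto)
    qed (use int in measurable)
    also have "\<dots> = c (sgn \<phi>)" using charge.M2.prob_space by simp
    finally show ?thesis using True by (simp add: G_def)
  next
    case False
    have "(\<integral>y. g (\<phi>, y) \<partial>radial_measure)
        = (\<integral>y. log_kernel (y - x) (\<theta> - \<phi>) - log_kernel (y - x) (0 - \<phi>) \<partial>radial_measure)"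
    proof (rule integral_cong_AE)
      show "AE y in radial_measure. g (\<phi>, y) = log_kernel (y - x) (\<theta> - \<phi>) - log_kernel (y - x) (0 - \<phi>)"
        using AEx by eventually_elim (use gval that False in auto)
    qed (use int in measurable)
    also have "\<dots> = r \<phi>"
      unfolding r_def ray_potential_def
      by (subst integral_radial, measurable, subst right_diff_distrib, rule Bochner_Integration.integral_diff)
        (rule integrable_density_log_kernel)+
    finally show ?thesis using False by (simp add: G_def)
  qed
  define Q where "Q = (\<lambda>\<theta>. integral {-pi..-(2*\<alpha>)} (\<lambda>\<phi>. ray_potential x (\<theta> - \<phi>))
      + integral {2*\<alpha>..pi} (\<lambda>\<phi>. ray_potential x (\<theta> - \<phi>)))"
  have cont: "continuous_on S (\<lambda>\<phi>. ray_potential x (\<theta> - \<phi>))" for S \<theta>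
    by (rule continuous_on_compose2[OF continuous_on_ray_potential[of UNIV]]) (auto intro!: continuous_intros)
  have r_int: "(r has_integral integral {a..b} (\<lambda>\<phi>. ray_potential x (\<theta> - \<phi>)) - integral {a..b} (\<lambda>\<phi>. ray_potential x (0 - \<phi>))) {a..b}" for a b
    unfolding r_def by (intro has_integral_diff integrable_integral integrable_continuous_real cont)
  \<comment> \<open>Cuts at \<open>\<plusminus> 2 * \<alpha>\<close> and 0 separate the rays, on the
    outer pieces, from the two atoms, one for each inner piece.\<close>
  have G: "(G has_integral (Q \<theta> - Q 0) + 2 * \<alpha> * (c 1 + c (- 1))) {-pi..pi}"
  proof -
    have 1: "(G has_integral integral {-pi..-(2*\<alpha>)} (\<lambda>\<phi>. ray_potential x (\<theta> - \<phi>)) - integral {-pi..-(2*\<alpha>)} (\<lambda>\<phi>. ray_potential x (0 - \<phi>))) {-pi..-(2*\<alpha>)}"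
      by (rule has_integral_eq[OF _ r_int]) (use alpha in \<open>auto simp: G_def\<close>)
    have 2: "(G has_integral 2 * \<alpha> * c (- 1)) {-(2*\<alpha>)..0}"
    proof (rule has_integral_spike_finite[where S="{-(2*\<alpha>), 0}"])
      show "((\<lambda>_. c (- 1)) has_integral 2 * \<alpha> * c (- 1)) {-(2*\<alpha>)..0}"
        using has_integral_const_real[of "c (- 1)" "-(2*\<alpha>)" 0] alpha by simp
    qed (auto simp: G_def)
    have 3: "(G has_integral 2 * \<alpha> * c 1) {0..2*\<alpha>}"
    proof (rule has_integral_spike_finite[where S="{2*\<alpha>, 0}"])
      show "((\<lambda>_. c 1) has_integral 2 * \<alpha> * c 1) {0..2*\<alpha>}"
        using has_integral_const_real[of "c 1" 0 "2*\<alpha>"] alpha by simp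
    qed (auto simp: G_def)
    have 4: "(G has_integral integral {2*\<alpha>..pi} (\<lambda>\<phi>. ray_potential x (\<theta> - \<phi>)) - integral {2*\<alpha>..pi} (\<lambda>\<phi>. ray_potential x (0 - \<phi>))) {2*\<alpha>..pi}"
      by (rule has_integral_eq[OF _ r_int]) (use alpha in \<open>auto simp: G_def\<close>)
    note 12 = has_integral_combine[OF _ _ 1 2]
    note 34 = has_integral_combine[OF _ _ 3 4]
    have "(G has_integral ((integral {-pi..-(2*\<alpha>)} (\<lambda>\<phi>. ray_potential x (\<theta> - \<phi>)) - integral {-pi..-(2*\<alpha>)} (\<lambda>\<phi>. ray_potential x (0 - \<phi>))) + 2 * \<alpha> * c (- 1))
       + (2 * \<alpha> * c 1 + (integral {2*\<alpha>..pi} (\<lambda>\<phi>. ray_potential x (\<theta> - \<phi>)) - integral {2*\<alpha>..pi} (\<lambda>\<phi>. ray_potential x (0 - \<phi>))))) {-pi..pi}"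
      using alpha by (intro has_integral_combine[OF _ _ 12 34]) auto
    thus ?thesis by (simp add: Q_def algebra_simps)
  qed
  \<comment> \<open>The same angular derivative is integrated twice: as a rotation average with
    \<open>c = 2 * \<alpha>\<close>, and explicitly.\<close>
  have "Q \<theta> - Q 0 = 2 * pi * ((E (min \<theta> (2 * \<alpha>)) - A \<theta>) - (E 0 - A 0))"
  proof (rule has_integral_unique)
    show "((\<lambda>t. ray_potential x (t - 2 * \<alpha>) - ray_potential x (t + 2 * \<alpha>)) has_integral Q \<theta> - Q 0) {0..\<theta>}"
      unfolding Q_def using alpha \<theta>
      by (intro rotation_average_diff continuous_on_ray_potential ray_potential_periodic) auto
    show "((\<lambda>t. ray_potential x (t - 2 * \<alpha>) - ray_potential x (t + 2 * \<alpha>)) has_integral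
       2 * pi * ((E (min \<theta> (2 * \<alpha>)) - A \<theta>) - (E 0 - A 0))) {0..\<theta>}"
      unfolding E_def A_def by (rule ray_potential_diff_integral[OF \<theta>])
  qed
  moreover have "2 * \<alpha> * (c 1 + c (- 1)) = 2 * pi * (A \<theta> - A 0)"
  proof -
    have "\<rho> * A t = log_kernel x (t - \<alpha>) + log_kernel x (t + \<alpha>)" for t
      using rho(3) by (simp add: A_def)
    hence "c 1 + c (- 1) = \<rho> * (A \<theta> - A 0)" by (simp add: c_def right_diff_distrib)
    hence "2 * \<alpha> * (c 1 + c (- 1)) = 2 * (\<rho> * \<alpha>) * (A \<theta> - A 0)" by simp
    thus ?thesis unfolding rho(2) .
  qed
  ultimately have S: "(Q \<theta> - Q 0) + 2 * \<alpha> * (c 1 + c (- 1)) = 2 * pi * (E (min \<theta> (2 * \<alpha>)) - E 0)"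
    by (simp add: algebra_simps)
  have "integral\<^sup>L ?P g = (\<integral>\<phi>. (\<integral>y. g (\<phi>, y) \<partial>radial_measure) \<partial>angle_measure)"
    by (rule charge.integral_fst'[OF int, symmetric])
  also have "\<dots> = (2 * pi * (E (min \<theta> (2 * \<alpha>)) - E 0)) / (2 * pi)"
  proof (rule integral_angle[where G=G])
    show "integrable angle_measure (\<lambda>\<phi>. \<integral>y. g (\<phi>, y) \<partial>radial_measure)"
      by (rule charge.integrable_fst'[OF int])
    show "AE \<phi> in angle_measure. (\<integral>y. g (\<phi>, y) \<partial>radial_measure) = G \<phi>"
    proof -
      have "AE \<phi> in angle_measure. \<phi> \<noteq> 0"
        using AE_lborel_singleton[of "0::real"] unfolding angle_measure_def by (subst AE_density) auto
      thus ?thesis by eventually_elim (rule inner)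
    qed
    show "(G has_integral 2 * pi * (E (min \<theta> (2 * \<alpha>)) - E 0)) {-pi..pi}" using G unfolding S .
  qed
  also have "\<dots> = E (min \<theta> (2 * \<alpha>)) - E 0" by simp
  also have "\<dots> \<le> 0"
  proof -
    have "0 < cosh (\<rho> * x) + cos (\<rho> * min \<theta> (2 * \<alpha>))"
      using \<theta> alpha by (intro cosh_plus_cos_pos) auto
    moreover have "cos (\<rho> * min \<theta> (2 * \<alpha>)) \<le> 1" by (rule cos_le_one)
    ultimately have "ln (cosh (\<rho> * x) + cos (\<rho> * min \<theta> (2 * \<alpha>))) \<le> ln (cosh (\<rho> * x) + 1)"
      by (subst ln_le_cancel_iff) linarith+
    thus ?thesis unfolding E_def using rho(1) by (simp add: divide_right_mono)
  qed
  finally have "integral\<^sup>L ?P g \<le> 0" .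
  moreover have "integral\<^sup>L ?P g = (\<integral>p. potential_kernel (exp (Complex x \<theta>)) (charge_point p) \<partial>?P)
     - (\<integral>p. potential_kernel (exp (Complex x 0)) (charge_point p) \<partial>?P)"
    unfolding g_def by (intro Bochner_Integration.integral_diff integrable_potential_kernel_charge \<theta> 0)
  ultimately show ?thesis
    unfolding potential_sector_measure[OF \<theta>] potential_sector_measure[OF 0] by simp
qed

text \<open>Logarithmic polar coordinates handle nonnegative arguments, with the atom treated
  separately since the potential is negative infinity there; conjugation handles the rest, and for
  \<open>z = 0\<close> both sides coincide.\<close>

lemma potential_sector_measure_le_cmod:
  "potential sector_measure z \<le> potential sector_measure (complex_of_real (cmod z))"
proof -
  have upper: "potential sector_measure z \<le> potential sector_measure (complex_of_real (cmod z))"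
    if z: "z \<noteq> 0" "0 \<le> Arg z" for z
  proof -
    define x where "x = ln (cmod z)"
    have ze: "z = exp (Complex x (Arg z))"
    proof -
      have "exp (Complex x (Arg z)) = complex_of_real (cmod z) * exp (\<i> * complex_of_real (Arg z))"
        using z(1) by (simp add: x_def exp_eq_polar)
      also have "\<dots> = z" by (rule Arg_eq[OF z(1), symmetric])
      finally show ?thesis ..
    qed
    have ce: "complex_of_real (cmod z) = exp (Complex x 0)"
      using z(1) by (simp add: x_def exp_eq_polar)
    show ?thesis
    proof (cases "x \<noteq> 0 \<or> Arg z \<noteq> \<alpha>")
      case True
      thus ?thesis using potential_sector_measure_le[of "Arg z" x] z(2) Arg_le_pi[of z] ze ce by simp
    next
      case False
      hence "z = exp (Complex 0 (\<alpha> * 1))" using ze by simp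
      hence "potential sector_measure z = - \<infinity>"
        using prob_space.finite_measure[OF prob_space_sector_measure] emeasure_atom[of 1]
        by (intro potential_at_atom sets_sector_measure) auto
      thus ?thesis by simp
    qed
  qed
  consider "z = 0" | "z \<noteq> 0" "0 \<le> Arg z" | "z \<noteq> 0" "Arg z < 0" by linarith
  thus ?thesis
  proof cases
    case 3
    \<comment> \<open>On the negative real axis conjugation would not change the sign of
      \<open>Arg\<close>.\<close>
    have "z \<notin> \<real>"
    proof
      assume "z \<in> \<real>"
      then obtain r where "z = complex_of_real r" by (auto elim: Reals_cases)
      thus False using 3(2) by (simp add: Arg_of_real split: if_splits)
    qed
    hence "Arg (cnj z) = - Arg z" using 3 by (simp add: Arg_cnj)
    hence "potential sector_measure (cnj z) \<le> potential sector_measure (complex_of_real (cmod (cnj z)))"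
      using 3 by (intro upper) auto
    thus ?thesis by (simp add: potential_cnj[OF sets_sector_measure distr_sector_measure_cnj])
  qed (use upper in auto)
qed

end

theorem mainTheorem3:
  fixes \<alpha> :: real
  assumes "0 < \<alpha>" and "\<alpha> < pi / 2"
  shows "\<exists>\<mu> :: complex measure.
           sets \<mu> = sets borel \<and> prob_space \<mu> \<and>
           symmetric_wrt_real_line \<mu> \<and>
           (\<forall>z. potential \<mu> z \<le> potential \<mu> (complex_of_real (cmod z))) \<and>
           measure \<mu> {z. z \<noteq> 0 \<and> \<bar>Arg z\<bar> \<le> \<alpha>} = 2 * \<alpha> / pi"
proof -
  interpret sector \<alpha> by unfold_locales (rule assms)+
  show ?thesis
    by (intro exI[of _ sector_measure] conjI allI sets_sector_measure prob_space_sector_measure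
        symmetric_sector_measure potential_sector_measure_le_cmod measure_sector_measure)
qed

end
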